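(* Suppose that (a) $(\Xi,\mathcal{B}_\Xi)$ and $(\Theta,\mathcal{B}_\Theta)$ are both isomorphic to Borel sets in a complete separable metric space; (b) if $\theta_1\ne\theta_2$ then there exists a measurable set $A\subset\Xi^{\mathbb{N}}$ with $\mathbb{P}^{\mathbb{N}}_{\theta_1}(A)\ne\mathbb{P}^{\mathbb{N}}_{\theta_2}(A)$; (c) $\Theta$ and $\mathcal{X}$ are compact, and $H(x,\cdot)$ is continuous on $\Theta$ for every $x\in\mathcal{X}$. Let $S_n:=\arg\min_{x\in\mathcal{X}}\rho_{\mathbb{P}_n}[H(x,\theta)]$ and $S:=\arg\min_{x\in\mathcal{X}}H(x,\theta^c)$, where under $\mu$ the true parameter $\theta^c$ is the realization of $\tilde\theta$. Then $\mathbb{D}(S_n,S)\to0$ as $n\to\infty$, $\mu$-almost surely, under the following condition for the respective choice of $\rho$: (i) for $\rho$ the mean or $\mathrm{CVaR}^\alpha$ ($\alpha\in(0,1)$): there exists a measurable $\kappa:\Theta\to\mathbb{R}^+$ with $|H(x,\theta)-H(y,\theta)|\le\kappa(\theta)\|x-y\|$ for all $x,y\in\mathcal{X}$ and $\theta\in\Theta$, and $\int_\Theta\kappa(\theta)\,\pi(d\theta)<\infty$; (ii) for $\rho$ the mean-variance functional $\mathbb{E}_{\mathbb{P}_n}[\cdot]+w\mathrm{Var}_{\mathbb{P}_n}[\cdot]$ ($w\ge0$): $H$ is jointly continuous on $\mathcal{X}\times\Theta$; (iii) for $\rho=\mathrm{VaR}^\alpha$ ($\alpha\in(0,1)$): the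 condition in (i) holds with $\|\kappa\|_\infty<\infty$.
   Context: Setting. $\Theta\subset\mathbb{R}^l$ carries its Borel $\sigma$-algebra $\mathcal{B}_\Theta$ and a prior probability measure $\pi$; $\Xi\subset\mathbb{R}^m$ carries its Borel $\sigma$-algebra $\mathcal{B}_\Xi$ and a family of probability measures $\{\mathbb{P}_\theta\}_{\theta\in\Theta}$. $\mathbb{P}^{\mathbb{N}}_\theta$ is the infinite product measure on $\Xi^{\mathbb{N}}$ (product $\sigma$-algebra $\mathcal{B}^{\mathbb{N}}_\Xi$); it is assumed that $\theta\mapsto\mathbb{P}^{\mathbb{N}}_\theta(B)$ is measurable for every $B\in\mathcal{B}^{\mathbb{N}}_\Xi$. On $\Omega=\Theta\times\Xi^{\mathbb{N}}$ with $\mathcal{F}=\mathcal{B}_\Theta\otimes\mathcal{B}_\Xi^{\mathbb{N}}$, $\mu$ is the probability measure determined by $\mu(A\times B)=\int_A\mathbb{P}^{\mathbb{N}}_\theta(B)\,\pi(d\theta)$. For $\omega=(\omega_\theta,\omega_\xi)\in\Omega$, $\tilde\theta(\omega):=\omega_\theta$ and $\xi_i(\omega):=(\omega_\xi)_i$; thus $\tilde\theta\sim\pi$ and, conditionally on $\tilde\theta$, the $\xi_i$ are i.i.d. from $\mathbb{P}_{\tilde\theta}$. With $\mathcal{F}_n=\sigma(\xi_1,\dots,\xi_n)$, the posterior $\mathbb{P}_n(\cdot)=\mu(\tilde\theta\in\cdot\mid\mathcal{F}_n)$ is the (regular) conditional distribution of $\tilde\theta$. $\mathcal{X}\subset\mathbb{R}^d$,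 $h:\mathbb{R}^d\times\mathbb{R}^m\to\mathbb{R}$, and $H(x,\theta):=\mathbb{E}_{\mathbb{P}_\theta}[h(x,\xi)]$ is assumed finite for all $(x,\theta)\in\mathcal{X}\times\Theta$. $\rho_{\mathbb{P}_n}[H(x,\theta)]$ means $\rho$ applied to the random variable $H(x,\theta)$ with $\theta\sim\mathbb{P}_n$. For a random variable $X$: $\mathrm{VaR}^\alpha(X):=\inf\{t:\mathbb{P}(X\le t)\ge\alpha\}$ and $\mathrm{CVaR}^\alpha(X):=\frac{1}{1-\alpha}\int_\alpha^1\mathrm{VaR}^r(X)\,dr$. For $A,B\subseteq\mathcal{X}$, $\mathbb{D}(A,B):=\sup_{x\in A}\inf_{y\in B}\|x-y\|$, where $\|\cdot\|$ is a norm on $\mathbb{R}^d$. $\|\kappa\|_\infty$ is the $L^\infty$ norm (with respect to $\pi$). *)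

theory Defs
  imports "HOL-Probability.Probability"
begin

abbreviation borel_on :: "'a::topological_space set \<Rightarrow> 'a measure" where
  "borel_on S \<equiv> restrict_space borel S"

definition measurably_isomorphic :: "'a measure \<Rightarrow> 'b measure \<Rightarrow> bool" where
  "measurably_isomorphic M N \<longleftrightarrow>
    (\<exists>f g. f \<in> M \<rightarrow>\<^sub>M N \<and> g \<in> N \<rightarrow>\<^sub>M M \<and>
      (\<forall>x\<in>space M. g (f x) = x) \<and> (\<forall>y\<in>space N. f (g y) = y))"

text \<open>An arbitrary norm, not necessarily the Euclidean norm of the type class.\<close>

definition is_norm :: "('a::real_vector \<Rightarrow> real) \<Rightarrow> bool" where
  "is_norm N \<longleftrightarrow>
    (\<forall>x. 0 \<le> N x) \<and> (\<forall>x. N x = 0 \<longleftrightarrow> x = 0) \<and>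
    (\<forall>c x. N (c *\<^sub>R x) = \<bar>c\<bar> * N x) \<and> (\<forall>x y. N (x + y) \<le> N x + N y)"

subsection \<open>The Bayesian model\<close>

definition seq_algebra :: "'x::topological_space set \<Rightarrow> (nat \<Rightarrow> 'x) measure" where
  "seq_algebra \<Xi> = (\<Pi>\<^sub>M i\<in>UNIV. borel_on \<Xi>)"

definition seq_law :: "('t \<Rightarrow> 'x measure) \<Rightarrow> 't \<Rightarrow> (nat \<Rightarrow> 'x) measure" where
  "seq_law P \<theta> = (\<Pi>\<^sub>M i\<in>UNIV. P \<theta>)"

definition is_joint_law ::
  "'t::topological_space set \<Rightarrow> 'x::topological_space set \<Rightarrow> 't measure \<Rightarrow> ('t \<Rightarrow> 'x measure)
    \<Rightarrow> ('t \<times> (nat \<Rightarrow> 'x)) measure \<Rightarrow> bool" where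
  "is_joint_law \<Theta> \<Xi> \<pi> P \<mu> \<longleftrightarrow>
    prob_space \<mu> \<and> sets \<mu> = sets (borel_on \<Theta> \<Otimes>\<^sub>M seq_algebra \<Xi>) \<and>
    (\<forall>A\<in>sets (borel_on \<Theta>). \<forall>B\<in>sets (seq_algebra \<Xi>).
      emeasure \<mu> (A \<times> B) = (\<integral>\<^sup>+\<theta>\<in>A. emeasure (seq_law P \<theta>) B \<partial>\<pi>))"

text \<open>The parameter is the first component of \<open>\<omega>\<close>. Observations are numbered from 0, so the first
  \<open>n\<close> observations are the coordinates \<open>i < n\<close>.\<close>

definition observation :: "nat \<Rightarrow> 't \<times> (nat \<Rightarrow> 'x) \<Rightarrow> 'x" where
  "observation i \<omega> = snd \<omega> i"

definition obs_algebra ::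
  "'x::topological_space set \<Rightarrow> ('t \<times> (nat \<Rightarrow> 'x)) measure \<Rightarrow> nat \<Rightarrow> ('t \<times> (nat \<Rightarrow> 'x)) measure" where
  "obs_algebra \<Xi> \<mu> n =
    sigma (space \<mu>) {observation i -` A \<inter> space \<mu> |i A. i < n \<and> A \<in> sets (borel_on \<Xi>)}"

text \<open>\<open>K\<close> is a version of the regular conditional distribution of \<open>Y\<close>, with values in \<open>N\<close>, given
  the sub-\<open>\<sigma>\<close>-algebra \<open>F\<close>. Membership in \<open>F \<rightarrow>\<^sub>M prob_algebra N\<close> says that \<open>K\<close> is a probability
  kernel, so \<open>\<omega> \<mapsto> K \<omega> A\<close> is \<open>F\<close>-measurable for each measurable \<open>A\<close>.\<close>

definition regular_cond_distr ::
  "'w measure \<Rightarrow> 'w measure \<Rightarrow> 't measure \<Rightarrow> ('w \<Rightarrow> 't) \<Rightarrow> ('w \<Rightarrow> 't measure) \<Rightarrow> bool" where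
  "regular_cond_distr M F N Y K \<longleftrightarrow>
    K \<in> F \<rightarrow>\<^sub>M prob_algebra N \<and>
    (\<forall>A\<in>sets N. AE \<omega> in M. measure (K \<omega>) A = real_cond_exp M F (\<lambda>\<omega>. indicator A (Y \<omega>)) \<omega>)"

subsection \<open>Risk functionals of a random variable \<open>X\<close> on a probability space \<open>M\<close>\<close>

definition mean_variance :: "real \<Rightarrow> 'a measure \<Rightarrow> ('a \<Rightarrow> real) \<Rightarrow> real" where
  "mean_variance w M X = prob_space.expectation M X + w * prob_space.variance M X"

definition VaR :: "real \<Rightarrow> 'a measure \<Rightarrow> ('a \<Rightarrow> real) \<Rightarrow> real" where
  "VaR \<alpha> M X = Inf {t. \<alpha> \<le> \<P>(x in M. X x \<le> t)}"

definition CVaR :: "real \<Rightarrow> 'a measure \<Rightarrow> ('a \<Rightarrow> real) \<Rightarrow> real" where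
  "CVaR \<alpha> M X = 1 / (1 - \<alpha>) * (LBINT r:{\<alpha>..1}. VaR r M X)"

subsection \<open>The optimization problem\<close>

definition mean_loss :: "('d \<Rightarrow> 'x \<Rightarrow> real) \<Rightarrow> ('t \<Rightarrow> 'x measure) \<Rightarrow> 'd \<Rightarrow> 't \<Rightarrow> real" where
  "mean_loss h P x \<theta> = prob_space.expectation (P \<theta>) (h x)"

definition argmin_set :: "'d set \<Rightarrow> ('d \<Rightarrow> real) \<Rightarrow> 'd set" where
  "argmin_set X f = {x. is_arg_min f (\<lambda>x. x \<in> X) x}"

text \<open>The values are extended reals, so that the supremum and infimum always have their usual
  meaning. In particular the deviation is \<open>-\<infinity>\<close> if \<open>A\<close> is empty and \<open>\<infinity>\<close> if only \<open>B\<close> is.\<close>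

definition deviation :: "('d::real_vector \<Rightarrow> real) \<Rightarrow> 'd set \<Rightarrow> 'd set \<Rightarrow> ereal" where
  "deviation N A B = (SUP x\<in>A. INF y\<in>B. ereal (N (x - y)))"

definition lipschitz_modulus ::
  "('d::real_vector \<Rightarrow> real) \<Rightarrow> 'd set \<Rightarrow> 't set \<Rightarrow> 't measure \<Rightarrow> ('d \<Rightarrow> 't \<Rightarrow> real) \<Rightarrow> ('t \<Rightarrow> real) \<Rightarrow> bool"
  where
  "lipschitz_modulus N X \<Theta> \<pi> H \<kappa> \<longleftrightarrow>
    \<kappa> \<in> borel_measurable \<pi> \<and> (\<forall>\<theta>\<in>\<Theta>. 0 \<le> \<kappa> \<theta>) \<and>
    (\<forall>x\<in>X. \<forall>y\<in>X. \<forall>\<theta>\<in>\<Theta>. \<bar>H x \<theta> - H y \<theta>\<bar> \<le> \<kappa> \<theta> * N (x - y)) \<and>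
    (\<integral>\<^sup>+\<theta>. ennreal (\<kappa> \<theta>) \<partial>\<pi>) < \<infinity>"

end

theory Submission
  imports Defs
begin

text \<open>
  By Hoeffding's inequality the empirical frequencies of a countable determining class of sets
  reveal, in the limit, the events \<open>P \<theta> U > q\<close>. These separate the points of \<open>\<Theta>\<close>, so by an
  argument as in Lusin's theorem every Borel event about the parameter agrees up to small
  probability with an event observed in finite time. Doob's maximal inequality then shows that the
  posterior of any such event tends to 0 almost surely where the event fails; hence almost surely
  the posteriors concentrate at the true parameter \<open>t\<close>. The maximal inequality also gives
  \<open>sup\<^sub>n \<integral>\<kappa> dP\<^sub>n < \<infinity>\<close>, so that \<open>\<integral>\<bar>H x \<theta> - H x t\<bar> dP\<^sub>n(\<theta>)\<close> tends to 0 uniformly in \<open>x\<close>. Mean,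
  mean-variance and CVaR are Lipschitz in \<open>L\<^sup>1\<close>, and VaR is close to a constant near that constant in
  \<open>L\<^sup>1\<close>, so the objectives converge uniformly to \<open>H x t\<close> and their minimizers follow.
\<close>

section \<open>Risk functionals\<close>

text \<open>The parameter is never recovered as a function of the infinite data. It suffices that an
  event about it is matched, up to probability \<delta>, by an event \<open>B\<close> known at some
  time m: the part of \<open>B\<close> where the parameter event fails has mass at most \<delta>, so
  from time m on the posterior of that failure rarely exceeds c on \<open>B\<close>, and \<delta> is
  sent to 0 with c fixed. Only an estimate for martingales enters, not their convergence.

  Two obstacles shape the rest. Almost sure statements come one event at a time, while
  neighbourhoods and decisions x range over uncountable sets: a countable base handles the former,
  and x is treated deterministically, for one fixed sequence of posteriors. In the Lipschitz cases
  \<kappa> is merely measurable and integrable under the prior, so concentration says nothing about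
  its posterior integrals; their boundedness is a separate almost sure fact, and it makes the L1
  errors equicontinuous in x.

  VaR stands apart: in general it is continuous in L1 only at constants. Continuity in x of the
  posterior VaR therefore comes from the essential bound on \<kappa>.\<close>

abbreviation unit_interval_measure :: "real measure" where
  "unit_interval_measure \<equiv> restrict_space lborel {0<..<1}"

context prob_space
begin

section \<open>Quantile functions and the quantile transform\<close>

lemma cdf_distr_eq:
  assumes [measurable]: "X \<in> borel_measurable M"
  shows "cdf (distr M borel X) t = prob {x \<in> space M. X x \<le> t}"
  unfolding cdf_def
  by (subst measure_distr) (auto intro!: arg_cong[where f="measure M"])

lemma cdf_distribution_distr:
  assumes [measurable]: "X \<in> borel_measurable M"
  shows "cdf_distribution (distr M borel X)"
  unfolding cdf_distribution_def by (rule real_distribution_distr) simp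

lemma VaR_eq_pseudoinverse:
  assumes "X \<in> borel_measurable M"
  shows "VaR r M X = Inf {t. r \<le> cdf (distr M borel X) t}"
  unfolding VaR_def cdf_distr_eq[OF assms] by simp

text \<open>Right-continuity of the distribution function makes the set in the definition of
  \<open>VaR\<close> a closed half-line; it is nonempty and bounded below because 0 < r < 1. The
  order properties of \<open>VaR\<close> are read off from this equivalence.\<close>

lemma VaR_le_iff:
  assumes "X \<in> borel_measurable M" "0 < r" "r < 1"
  shows "VaR r M X \<le> t \<longleftrightarrow> r \<le> prob {x \<in> space M. X x \<le> t}"
proof -
  interpret D: cdf_distribution "distr M borel X" by (rule cdf_distribution_distr[OF assms(1)])
  show ?thesis
    using D.pseudoinverse[OF assms(2,3), of t]
    by (simp add: VaR_eq_pseudoinverse[OF assms(1)] cdf_distr_eq[OF assms(1)])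
qed

lemma VaR_const: "0 < r \<Longrightarrow> r < 1 \<Longrightarrow> VaR r M (\<lambda>_. c) = c"
proof -
  assume r: "0 < r" "r < 1"
  have "VaR r M (\<lambda>_. c) \<le> t \<longleftrightarrow> c \<le> t" for t
    using r by (subst VaR_le_iff) (cases "c \<le> t"; simp add: prob_space)+
  then show ?thesis by (meson order.refl order.antisym)
qed

lemma VaR_mono_level:
  assumes "X \<in> borel_measurable M" "0 < r" "r \<le> s" "s < 1"
  shows "VaR r M X \<le> VaR s M X"
  using VaR_le_iff[OF assms(1), of s "VaR s M X"] VaR_le_iff[OF assms(1), of r "VaR s M X"] assms
  by simp

lemma measurable_VaR:
  assumes "X \<in> borel_measurable M"
  shows "(\<lambda>r. VaR r M X) \<in> borel_measurable (restrict_space borel {0<..<1})"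
  by (rule borel_measurable_mono_on_fnc) (auto simp: mono_on_def intro!: VaR_mono_level[OF assms])

lemma measurable_VaR':
  assumes "X \<in> borel_measurable M"
  shows "(\<lambda>r. VaR r M X) \<in> borel_measurable unit_interval_measure"
  using measurable_VaR[OF assms] by (simp cong: measurable_cong_sets add: sets_restrict_space)

text \<open>For a uniform level r, the event that the quantile at r is at most t is the event that r
  is at most the distribution function at t, and so has the right probability. This turns integrals
  over levels into expectations.\<close>

lemma distr_VaR:
  assumes "X \<in> borel_measurable M"
  shows "distr unit_interval_measure borel (\<lambda>r. VaR r M X) = distr M borel X"
proof -
  interpret D: cdf_distribution "distr M borel X" by (rule cdf_distribution_distr[OF assms])
  show ?thesis using D.distr_I_eq_M by (simp add: VaR_eq_pseudoinverse[OF assms])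
qed

lemma integrable_VaR:
  assumes X: "X \<in> borel_measurable M" and g: "g \<in> borel_measurable borel"
    and int: "integrable M (\<lambda>x. g (X x) :: real)"
  shows "integrable unit_interval_measure (\<lambda>r. g (VaR r M X))"
  using int integrable_distr_eq[OF X g] integrable_distr_eq[OF measurable_VaR'[OF X] g]
  by (simp add: distr_VaR[OF X])

lemma integral_VaR:
  assumes X: "X \<in> borel_measurable M" and g: "g \<in> borel_measurable borel"
  shows "(\<integral>r. g (VaR r M X) \<partial>unit_interval_measure) = expectation (\<lambda>x. g (X x) :: real)"
  using integral_distr[OF X g] integral_distr[OF measurable_VaR'[OF X] g]
  by (simp add: distr_VaR[OF X])

section \<open>CVaR: variational formula and Lipschitz bound in L1\<close>

lemma CVaR_eq_integral:
  assumes X: "X \<in> borel_measurable M" and \<alpha>: "0 < \<alpha>" "\<alpha> < 1"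
  shows "CVaR \<alpha> M X =
    1 / (1 - \<alpha>) * (\<integral>r. indicator {\<alpha>..} r * VaR r M X \<partial>unit_interval_measure)"
proof -
  let ?q = "\<lambda>r. VaR r M X"
  have q: "(\<lambda>r. indicator {0<..<1} r * ?q r) \<in> borel_measurable borel"
    using measurable_VaR[OF X] by (subst (asm) borel_measurable_restrict_space_iff) (auto simp: mult.commute)
  \<comment> \<open>Level 1 gets its own summand: there the infimum may run over an empty set, and
    monotonicity gives measurability only inside the open interval. Being one point, it does not
    change the integral.\<close>
  have "(\<lambda>r. indicator {\<alpha>..} r * (indicator {0<..<1} r * ?q r) + indicator {1} r * ?q 1) \<in> borel_measurable borel"
    using q by measurable
  also have "(\<lambda>r. indicator {\<alpha>..} r * (indicator {0<..<1} r * ?q r) + indicator {1} r * ?q 1)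
     = (\<lambda>r. indicator {\<alpha>..1} r * ?q r)"
    using \<alpha> by (auto simp: fun_eq_iff indicator_def)
  finally have m: "(\<lambda>r. indicator {\<alpha>..1} r * ?q r) \<in> borel_measurable borel" .
  have "(LBINT r:{\<alpha>..1}. ?q r) = (\<integral>r. indicator {\<alpha>..} r * (indicator {0<..<1} r * ?q r) \<partial>lborel)"
    unfolding set_lebesgue_integral_def
    using m q AE_lborel_singleton[of 1] \<alpha>
    by (intro integral_cong_AE) (auto elim!: eventually_mono split: split_indicator)
  also have "\<dots> = (\<integral>r. indicator {\<alpha>..} r * ?q r \<partial>unit_interval_measure)"
    by (subst integral_restrict_space) (auto intro!: Bochner_Integration.integral_cong)
  finally show ?thesis by (simp add: CVaR_def)
qed

text \<open>The variational formula of Rockafellar and Uryasev. The quantile function is monotone, so that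
  restricting \<open>q r - t\<close> to \<open>r \<ge> \<alpha>\<close> gives at most its positive part, with equality for \<open>t = q \<alpha>\<close>.\<close>

lemma
  assumes int: "integrable M X" and \<alpha>: "0 < \<alpha>" "\<alpha> < 1"
  shows CVaR_le: "CVaR \<alpha> M X \<le> t + expectation (\<lambda>x. max 0 (X x - t)) / (1 - \<alpha>)"
    and CVaR_eq: "CVaR \<alpha> M X = VaR \<alpha> M X + expectation (\<lambda>x. max 0 (X x - VaR \<alpha> M X)) / (1 - \<alpha>)"
proof -
  let ?q = "\<lambda>r. VaR r M X" and ?U = unit_interval_measure
  have X[measurable]: "X \<in> borel_measurable M" using int by simp
  note [measurable] = measurable_VaR'[OF X]
  interpret U: prob_space ?U
    by (auto simp add: emeasure_restrict_space space_restrict_space intro!: prob_spaceI)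
  have q: "integrable ?U ?q" using integrable_VaR[OF X, of "\<lambda>x. x"] int by simp
  have i\<alpha>: "integrable ?U (\<lambda>r. indicator {\<alpha>..} r :: real)"
    by (rule U.integrable_const_bound[of _ 1]) (auto simp: indicator_def measurable_restrict_space1)
  have [measurable]: "(\<lambda>r. indicator {\<alpha>..} r :: real) \<in> borel_measurable ?U"
    by (auto intro!: measurable_restrict_space1)
  have int1: "integrable ?U (\<lambda>r. indicator {\<alpha>..} r * (?q r - t))" for t
  proof (rule Bochner_Integration.integrable_bound)
    show "integrable ?U (\<lambda>r. ?q r - t)" using q by simp
  qed (measurable, auto simp: indicator_def)
  have int2: "integrable ?U (\<lambda>r. max 0 (?q r - t))" for t
    using q by (intro integrable_max) auto
  have "(\<integral>r. indicator {\<alpha>..} r \<partial>?U) = measure lborel ({\<alpha>..} \<inter> {0<..<1})"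
    by (simp add: measure_restrict_space space_restrict_space)
  also have "{\<alpha>..} \<inter> {0<..<1} = {\<alpha>..<1}" using \<alpha> by auto
  also have "measure lborel {\<alpha>..<1} = 1 - \<alpha>" using \<alpha> by simp
  finally have m: "(\<integral>r. indicator {\<alpha>..} r \<partial>?U) = 1 - \<alpha>" .
  have eq: "(\<integral>r. indicator {\<alpha>..} r * (?q r - t) \<partial>?U) = (1 - \<alpha>) * (CVaR \<alpha> M X - t)" for t
  proof -
    have "(\<integral>r. indicator {\<alpha>..} r * ?q r \<partial>?U)
      = (\<integral>r. indicator {\<alpha>..} r * (?q r - t) + t * indicator {\<alpha>..} r \<partial>?U)"
      by (intro Bochner_Integration.integral_cong) (auto simp: algebra_simps)
    also have "\<dots> = (\<integral>r. indicator {\<alpha>..} r * (?q r - t) \<partial>?U) + t * (1 - \<alpha>)"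
      using int1 i\<alpha> m by (subst Bochner_Integration.integral_add) auto
    finally show ?thesis using CVaR_eq_integral[OF X \<alpha>] \<alpha> by (simp add: field_simps)
  qed
  have E: "(\<integral>r. max 0 (?q r - t) \<partial>?U) = expectation (\<lambda>x. max 0 (X x - t))" for t
    by (rule integral_VaR[OF X]) simp
  have "(1 - \<alpha>) * (CVaR \<alpha> M X - t) \<le> (\<integral>r. max 0 (?q r - t) \<partial>?U)"
    unfolding eq[symmetric] by (rule integral_mono[OF int1 int2]) (auto simp: indicator_def)
  then show "CVaR \<alpha> M X \<le> t + expectation (\<lambda>x. max 0 (X x - t)) / (1 - \<alpha>)"
    using \<alpha> by (simp add: E field_simps)
  have "(\<integral>r. indicator {\<alpha>..} r * (?q r - ?q \<alpha>) \<partial>?U) = (\<integral>r. max 0 (?q r - ?q \<alpha>) \<partial>?U)"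
    using VaR_mono_level[OF X, of \<alpha>] VaR_mono_level[OF X, of _ \<alpha>] \<alpha>
    by (intro Bochner_Integration.integral_cong)
       (auto simp: space_restrict_space indicator_def max_def intro!: antisym)
  then show "CVaR \<alpha> M X = VaR \<alpha> M X + expectation (\<lambda>x. max 0 (X x - VaR \<alpha> M X)) / (1 - \<alpha>)"
    using \<alpha> unfolding E eq by (simp add: field_simps)
qed

lemma CVaR_const: "0 < \<alpha> \<Longrightarrow> \<alpha> < 1 \<Longrightarrow> CVaR \<alpha> M (\<lambda>_. c) = c"
  using CVaR_eq[of "\<lambda>_. c" \<alpha>] by (simp add: VaR_const)

text \<open>The optimal t for \<open>Y\<close> is used as a trial value for \<open>X\<close> in the
  variational formula; the positive part is 1-Lipschitz.\<close>

lemma CVaR_diff_le: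
  assumes X: "integrable M X" and Y: "integrable M Y" and \<alpha>: "0 < \<alpha>" "\<alpha> < 1"
  shows "CVaR \<alpha> M X - CVaR \<alpha> M Y \<le> expectation (\<lambda>x. \<bar>X x - Y x\<bar>) / (1 - \<alpha>)"
proof -
  let ?t = "VaR \<alpha> M Y"
  have "expectation (\<lambda>x. max 0 (X x - ?t))
      \<le> expectation (\<lambda>x. max 0 (Y x - ?t) + \<bar>X x - Y x\<bar>)"
    using X Y by (intro integral_mono) auto
  also have "\<dots> = expectation (\<lambda>x. max 0 (Y x - ?t)) + expectation (\<lambda>x. \<bar>X x - Y x\<bar>)"
    using X Y by (intro Bochner_Integration.integral_add) auto
  finally show ?thesis
    using CVaR_le[OF X \<alpha>, of ?t] CVaR_eq[OF Y \<alpha>] \<alpha> by (simp add: field_simps)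
qed

lemma CVaR_lipschitz:
  assumes X: "integrable M X" and Y: "integrable M Y" and \<alpha>: "0 < \<alpha>" "\<alpha> < 1"
  shows "\<bar>CVaR \<alpha> M X - CVaR \<alpha> M Y\<bar> \<le> 1 / (1 - \<alpha>) * expectation (\<lambda>x. \<bar>X x - Y x\<bar>)"
  using CVaR_diff_le[OF X Y \<alpha>] CVaR_diff_le[OF Y X \<alpha>] by (auto simp: abs_minus_commute abs_le_iff)

section \<open>Continuity of mean, mean-variance and VaR\<close>

lemma expectation_lipschitz:
  assumes X: "integrable M X" and Y: "integrable M Y"
  shows "\<bar>expectation X - expectation Y\<bar> \<le> expectation (\<lambda>x. \<bar>X x - Y x :: real\<bar>)"
  using integral_abs_bound[of M "\<lambda>x. X x - Y x"] X Y by simp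

lemma mean_variance_const: "mean_variance w M (\<lambda>_. c) = c"
  by (simp add: mean_variance_def prob_space)

text \<open>On functions bounded by \<open>B\<close> the square is 2B-Lipschitz. The second moment
  and the squared mean each contribute 2B, whence 4B for the variance.\<close>

lemma mean_variance_lipschitz:
  assumes [measurable]: "X \<in> borel_measurable M" "Y \<in> borel_measurable M" and w: "0 \<le> w"
    and X: "\<And>x. x \<in> space M \<Longrightarrow> \<bar>X x\<bar> \<le> B" and Y: "\<And>x. x \<in> space M \<Longrightarrow> \<bar>Y x\<bar> \<le> B"
  shows "\<bar>mean_variance w M X - mean_variance w M Y\<bar> \<le> (1 + 4 * B * w) * expectation (\<lambda>x. \<bar>X x - Y x\<bar>)"
proof -
  let ?d = "expectation (\<lambda>x. \<bar>X x - Y x\<bar>)"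
  have sq: "integrable M Z" "integrable M (\<lambda>x. (Z x)\<^sup>2)" "\<bar>expectation Z\<bar> \<le> B"
    if [measurable]: "Z \<in> borel_measurable M" and Z: "\<And>x. x \<in> space M \<Longrightarrow> \<bar>Z x\<bar> \<le> B" for Z
  proof -
    show i: "integrable M Z" by (rule integrable_const_bound[of _ B]) (auto simp: Z)
    have "\<bar>Z x\<bar>\<^sup>2 \<le> B\<^sup>2" if "x \<in> space M" for x
      using Z[OF that] by (intro power_mono) auto
    then show "integrable M (\<lambda>x. (Z x)\<^sup>2)"
      by (intro integrable_const_bound[of _ "B\<^sup>2"]) auto
    have "expectation (\<lambda>x. \<bar>Z x\<bar>) \<le> expectation (\<lambda>_. B)"
      using i Z by (intro integral_mono) auto
    then show "\<bar>expectation Z\<bar> \<le> B"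
      by (intro order_trans[OF integral_abs_bound]) (simp add: prob_space)
  qed
  note sX = sq[OF assms(1) X] and sY = sq[OF assms(2) Y]
  have d: "\<bar>expectation X - expectation Y\<bar> \<le> ?d"
    using sX sY by (intro expectation_lipschitz) auto
  have "\<bar>expectation (\<lambda>x. (X x)\<^sup>2) - expectation (\<lambda>x. (Y x)\<^sup>2)\<bar>
      \<le> expectation (\<lambda>x. \<bar>(X x)\<^sup>2 - (Y x)\<^sup>2\<bar>)"
    using sX sY by (intro expectation_lipschitz) auto
  also have "\<dots> \<le> expectation (\<lambda>x. 2 * B * \<bar>X x - Y x\<bar>)"
  proof (intro integral_mono)
    show "\<bar>(X x)\<^sup>2 - (Y x)\<^sup>2\<bar> \<le> 2 * B * \<bar>X x - Y x\<bar>" if "x \<in> space M" for x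
    proof -
      have "\<bar>(X x)\<^sup>2 - (Y x)\<^sup>2\<bar> = \<bar>X x + Y x\<bar> * \<bar>X x - Y x\<bar>"
        by (simp add: abs_mult[symmetric] power2_eq_square algebra_simps)
      also have "\<dots> \<le> 2 * B * \<bar>X x - Y x\<bar>"
        using X[OF that] Y[OF that] by (intro mult_right_mono) auto
      finally show ?thesis .
    qed
  qed (use sX sY in auto)
  finally have s: "\<bar>expectation (\<lambda>x. (X x)\<^sup>2) - expectation (\<lambda>x. (Y x)\<^sup>2)\<bar> \<le> 2 * B * ?d" by simp
  have "\<bar>(expectation X)\<^sup>2 - (expectation Y)\<^sup>2\<bar> = \<bar>expectation X + expectation Y\<bar> * \<bar>expectation X - expectation Y\<bar>"
    by (simp add: abs_mult[symmetric] power2_eq_square algebra_simps)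
  also have "\<dots> \<le> (2 * B) * ?d"
    using sX(3) sY(3) d by (intro mult_mono) auto
  finally have "\<bar>variance X - variance Y\<bar> \<le> 4 * B * ?d"
    using s sX sY by (simp add: variance_eq)
  then have "\<bar>w * (variance X - variance Y)\<bar> \<le> w * (4 * B * ?d)"
    unfolding abs_mult using w by (intro mult_mono) auto
  then show ?thesis
    using d unfolding mean_variance_def by (simp add: algebra_simps abs_le_iff)
qed

text \<open>An almost sure shift by at most \<delta> moves every quantile by at most \<delta>.
  Closeness in L1 would not do: at a jump of the quantile function, moving a small mass changes
  \<open>VaR\<close> by the whole jump.\<close>

lemma VaR_lipschitz:
  assumes [measurable]: "X \<in> borel_measurable M" "Y \<in> borel_measurable M"
    and \<alpha>: "0 < \<alpha>" "\<alpha> < 1" and le: "AE x in M. \<bar>X x - Y x\<bar> \<le> \<delta>"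
  shows "\<bar>VaR \<alpha> M X - VaR \<alpha> M Y\<bar> \<le> \<delta>"
proof -
  have *: "VaR \<alpha> M X \<le> VaR \<alpha> M Y + \<delta>"
    if [measurable]: "X \<in> borel_measurable M" "Y \<in> borel_measurable M" and le: "AE x in M. \<bar>X x - Y x\<bar> \<le> \<delta>"
    for X Y
  proof -
    have "\<alpha> \<le> prob {x \<in> space M. Y x \<le> VaR \<alpha> M Y}"
      using VaR_le_iff[of Y \<alpha> "VaR \<alpha> M Y"] \<alpha> by simp
    also have "\<dots> \<le> prob {x \<in> space M. X x \<le> VaR \<alpha> M Y + \<delta>}"
      using le by (intro finite_measure_mono_AE) auto
    finally show ?thesis using VaR_le_iff[of X \<alpha>] \<alpha> by simp
  qed
  show ?thesis
    using *[OF assms(1,2) le] *[OF assms(2,1)] le by (simp add: abs_minus_commute abs_le_iff)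
qed

text \<open>A constant has the same quantile at every level in (0,1), so its quantile function has
  no jump there. By Markov's inequality deviations of size \<epsilon> have probability below both 1
  - \<alpha>, which leaves mass at least \<alpha> below c + \<epsilon>, and \<alpha>, which leaves
  mass less than \<alpha> below c - \<epsilon>.\<close>

lemma VaR_near_const:
  assumes int: "integrable M (\<lambda>x. \<bar>X x - c\<bar>)" and [measurable]: "X \<in> borel_measurable M"
    and \<alpha>: "0 < \<alpha>" "\<alpha> < 1" and \<epsilon>: "0 < \<epsilon>"
    and small: "expectation (\<lambda>x. \<bar>X x - c\<bar>) < \<epsilon> * min \<alpha> (1 - \<alpha>)"
  shows "\<bar>VaR \<alpha> M X - c\<bar> \<le> \<epsilon>"
proof -
  let ?D = "{x \<in> space M. \<epsilon> \<le> \<bar>X x - c\<bar>}"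
  have "prob ?D \<le> expectation (\<lambda>x. \<bar>X x - c\<bar>) / \<epsilon>"
    using int \<epsilon> integral_Markov_inequality_measure[of M "\<lambda>x. \<bar>X x - c\<bar>" "{}" \<epsilon>] by auto
  also have "\<dots> < min \<alpha> (1 - \<alpha>)" using small pos_divide_less_eq[OF \<epsilon>] by (metis mult.commute)
  finally have D: "prob ?D < \<alpha>" "prob ?D < 1 - \<alpha>" by auto
  have "1 - prob ?D = prob (space M - ?D)" by (rule prob_compl[symmetric]) measurable
  also have "\<dots> \<le> prob {x \<in> space M. X x \<le> c + \<epsilon>}" by (rule finite_measure_mono) auto
  finally have "\<alpha> \<le> prob {x \<in> space M. X x \<le> c + \<epsilon>}" using D(2) by simp
  then have up: "VaR \<alpha> M X \<le> c + \<epsilon>" using VaR_le_iff[of X \<alpha>] \<alpha> by simp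
  have "prob {x \<in> space M. X x \<le> c - \<epsilon>} \<le> prob ?D" by (rule finite_measure_mono) auto
  then have "\<not> VaR \<alpha> M X \<le> c - \<epsilon>" using VaR_le_iff[of X \<alpha>] \<alpha> D by simp
  with up show ?thesis by simp
qed

end

section \<open>Stability of minimizers\<close>

lemma is_norm_triangle_diff:
  assumes "is_norm N"
  shows "\<bar>N x - N y\<bar> \<le> N (x - y)"
proof -
  have add: "N (u + v) \<le> N u + N v" and sc: "N (c *\<^sub>R u) = \<bar>c\<bar> * N u" for u v c
    using assms unfolding is_norm_def by blast+
  have "N x \<le> N (x - y) + N y" "N y \<le> N (y - x) + N x"
    using add[of "x - y" y] add[of "y - x" x] by simp_all
  moreover have "N (y - x) = N (x - y)"
    using sc[of "-1" "x - y"] by simp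
  ultimately show ?thesis by linarith
qed

text \<open>Expansion in the orthonormal basis. This direction of the comparison with the Euclidean
  norm makes \<open>N\<close> continuous for the topology in which compactness of the decision set
  is expressed.\<close>

lemma is_norm_bound:
  fixes N :: "'a::euclidean_space \<Rightarrow> real"
  assumes "is_norm N"
  obtains C where "0 < C" "\<And>x. N x \<le> C * norm x"
proof -
  define C where "C = 1 + (\<Sum>b\<in>Basis. N b)"
  have nn: "0 \<le> N x" and add: "N (x + y) \<le> N x + N y" and sc: "N (c *\<^sub>R x) = \<bar>c\<bar> * N x"
    and z: "N 0 = 0" for x y c
    using assms unfolding is_norm_def by blast+
  have sum: "N (sum f A) \<le> (\<Sum>i\<in>A. N (f i))" if "finite A" for f and A :: "'a set"
    using that by induction (auto simp: z intro: order_trans[OF add])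
  have "N x \<le> C * norm x" for x
  proof -
    have "N x = N (\<Sum>b\<in>Basis. (x \<bullet> b) *\<^sub>R b)" by (simp add: euclidean_representation)
    also have "\<dots> \<le> (\<Sum>b\<in>Basis. N ((x \<bullet> b) *\<^sub>R b))" by (rule sum) simp
    also have "\<dots> \<le> (\<Sum>b\<in>Basis. norm x * N b)"
      by (intro sum_mono) (auto simp: sc nn Basis_le_norm intro!: mult_right_mono)
    also have "\<dots> = (C - 1) * norm x" by (simp add: C_def sum_distrib_left mult.commute)
    also have "\<dots> \<le> C * norm x" by (intro mult_right_mono) auto
    finally show ?thesis .
  qed
  moreover have "0 < C" unfolding C_def by (simp add: add_pos_nonneg nn sum_nonneg)
  ultimately show ?thesis using that by blast
qed

lemma continuous_on_is_norm:
  fixes N :: "'a::euclidean_space \<Rightarrow> real"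
  assumes "is_norm N"
  shows "continuous_on A N"
proof -
  obtain C where C: "0 < C" "\<And>x. N x \<le> C * norm x" using is_norm_bound[OF assms] by blast
  have "C-lipschitz_on A N"
  proof (rule lipschitz_onI)
    show "dist (N x) (N y) \<le> C * dist x y" for x y
      using is_norm_triangle_diff[OF assms, of x y] C(2)[of "x - y"] by (simp add: dist_norm)
  qed (use C(1) in simp)
  then show ?thesis by (rule lipschitz_on_continuous_on)
qed

lemma argmin_set_nonempty:
  assumes "compact X" "X \<noteq> {}" "continuous_on X (f :: _ \<Rightarrow> real)"
  shows "argmin_set X f \<noteq> {}"
  using continuous_attains_inf[OF assms] unfolding argmin_set_def is_arg_min_def
  by (auto simp: not_less)

text \<open>On the compact set of points at \<open>N\<close>-distance at least \<epsilon> from all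
  minimizers, \<open>f\<close> stays above its minimum by a fixed gap, which a uniformly close
  function cannot bridge. Continuity of \<open>g n\<close> provides a minimizer of
  \<open>g n\<close>, and with it the lower bound 0 for the deviation, which would be -\<infinity>
  for an empty argmin set.\<close>

lemma deviation_argmin_tendsto:
  fixes X :: "'a::euclidean_space set" and f :: "'a \<Rightarrow> real"
  assumes N: "is_norm N" and X: "compact X" "X \<noteq> {}"
    and f: "continuous_on X f" and g: "\<And>n. continuous_on X (g n)"
    and lim: "uniform_limit X g f sequentially"
  shows "(\<lambda>n. deviation N (argmin_set X (g n)) (argmin_set X f)) \<longlonglongrightarrow> 0"
proof (rule order_tendstoI)
  let ?S = "argmin_set X f"
  have nn: "0 \<le> N x" for x using N by (auto simp: is_norm_def)
  have "0 \<le> deviation N (argmin_set X (g n)) ?S" for n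
  proof -
    obtain x where "x \<in> argmin_set X (g n)" using argmin_set_nonempty[OF X g[of n]] by auto
    then show ?thesis
      unfolding deviation_def by (rule SUP_upper2) (auto intro!: INF_greatest simp: nn)
  qed
  then show "\<forall>\<^sub>F n in sequentially. a < deviation N (argmin_set X (g n)) ?S" if "a < 0" for a
    using that less_le_trans by (intro always_eventually allI) blast
  obtain s where s: "s \<in> ?S" using argmin_set_nonempty[OF X f] by auto
  then have sX: "s \<in> X" and sf: "\<And>x. x \<in> X \<Longrightarrow> f s \<le> f x"
    by (auto simp: argmin_set_def is_arg_min_def not_less)
  fix a :: ereal assume "0 < a"
  then obtain \<epsilon> where \<epsilon>: "0 < \<epsilon>" "ereal \<epsilon> < a"
    by (metis ereal_dense2 less_ereal.simps(1) zero_ereal_def)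
  define Z where "Z = {x \<in> X. \<forall>y\<in>?S. \<epsilon> \<le> N (x - y)}"
  have "closed {x \<in> X. \<epsilon> \<le> N (x - y)}" for y
  proof (rule continuous_on_closed_Collect_le)
    show "continuous_on X (\<lambda>x. N (x - y))"
      by (rule continuous_on_compose2[OF continuous_on_is_norm[OF N, of UNIV]])
         (auto intro!: continuous_intros)
  qed (use X(1) in \<open>auto simp: compact_imp_closed\<close>)
  moreover have "Z = X \<inter> (\<Inter>y\<in>?S. {x \<in> X. \<epsilon> \<le> N (x - y)})" by (auto simp: Z_def)
  ultimately have "compact Z" using X(1) by (auto intro!: compact_Int_closed)
  \<comment> \<open>The gap is 2 * \<eta> because uniform closeness is used twice below, at a
    minimizer of \<open>g n\<close> and at \<open>s\<close>, with error \<eta> each time.\<close>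
  have "\<exists>\<eta>>0. \<forall>x\<in>Z. f s + 2 * \<eta> \<le> f x"
  proof (cases "Z = {}")
    case False
    have "continuous_on Z f" using f by (rule continuous_on_subset) (auto simp: Z_def)
    then obtain z where z: "z \<in> Z" "\<And>x. x \<in> Z \<Longrightarrow> f z \<le> f x"
      using continuous_attains_inf[OF \<open>compact Z\<close> False] by blast
    have "z \<notin> ?S"
    proof
      assume "z \<in> ?S"
      with z(1) have "\<epsilon> \<le> N (z - z)" unfolding Z_def by blast
      moreover have "N 0 = 0" using N unfolding is_norm_def by blast
      ultimately show False using \<epsilon>(1) by simp
    qed
    then obtain y where "y \<in> X" "f y < f z"
      using z(1) by (auto simp: argmin_set_def is_arg_min_def Z_def)
    with sf have "f s < f z" by fastforce
    with z(2) show ?thesis by (intro exI[of _ "(f z - f s) / 2"]) (auto simp: field_simps)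
  qed (auto intro!: exI[of _ 1])
  then obtain \<eta> where \<eta>: "0 < \<eta>" "\<And>x. x \<in> Z \<Longrightarrow> f s + 2 * \<eta> \<le> f x" by blast
  have "\<forall>\<^sub>F n in sequentially. \<forall>x\<in>X. dist (g n x) (f x) < \<eta>"
    using uniform_limitD[OF lim \<eta>(1)] .
  then show "\<forall>\<^sub>F n in sequentially. deviation N (argmin_set X (g n)) ?S < a"
  proof eventually_elim
    case (elim n)
    have "(INF y\<in>?S. ereal (N (x - y))) \<le> ereal \<epsilon>" if x: "x \<in> argmin_set X (g n)" for x
    proof -
      have xX: "x \<in> X" and "g n x \<le> g n s"
        using x sX by (auto simp: argmin_set_def is_arg_min_def not_less)
      moreover have "\<bar>g n x - f x\<bar> < \<eta>" "\<bar>g n s - f s\<bar> < \<eta>"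
        using elim xX s by (auto simp: dist_real_def argmin_set_def is_arg_min_def)
      ultimately have "f x < f s + 2 * \<eta>" by linarith
      then have "x \<notin> Z" using \<eta>(2) by fastforce
      then obtain y where "y \<in> ?S" "N (x - y) < \<epsilon>" using xX by (auto simp: Z_def not_le)
      then show ?thesis by (intro INF_lower2[of y]) auto
    qed
    then have "deviation N (argmin_set X (g n)) ?S \<le> ereal \<epsilon>"
      unfolding deviation_def by (intro SUP_least)
    then show ?case using \<epsilon>(2) by (rule le_less_trans)
  qed
qed

section \<open>Approximation by separating sets\<close>

text \<open>Inner regularity of finite Borel measures on a Polish space, put into the form of a
  small remainder.\<close>

lemma compact_inner_approx:
  fixes M :: "'a::polish_space measure"
  assumes M: "sets M = sets borel" "finite_measure M" and B: "B \<in> sets borel" and e: "0 < e"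
  obtains C where "C \<subseteq> B" "compact C" "measure M (B - C) < e"
proof -
  interpret finite_measure M by fact
  have B': "B \<in> sets M" using M B by simp
  have "\<exists>C\<in>{K. K \<subseteq> B \<and> compact K}. emeasure M B < emeasure M C + ennreal e"
  \<comment> \<open>Subtracting e gives a strictly smaller extended nonnegative number only if
    \<open>emeasure M B\<close> is positive, since subtraction is truncated at 0.\<close>
  proof (cases "emeasure M B = 0")
    case True
    then show ?thesis using e by (intro bexI[of _ "{}"]) auto
  next
    case False
    have eq: "emeasure M B = (SUP K\<in>{K. K \<subseteq> B \<and> compact K}. emeasure M K)"
      using M B by (intro inner_regular) auto
    have "emeasure M B - ennreal e < emeasure M B"
      using False e by (intro ennreal_between) (auto simp: zero_less_iff_neq_zero emeasure_eq_measure)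
    then obtain C where "C \<subseteq> B" "compact C" "emeasure M B - ennreal e < emeasure M C"
      unfolding eq less_SUP_iff by (auto simp: eq)
    then have "\<not> measure M C \<le> measure M B - e"
      using e ennreal_leI[of "measure M C" "measure M B - e"]
      by (auto simp: emeasure_eq_measure ennreal_minus not_le[symmetric])
    with \<open>C \<subseteq> B\<close> \<open>compact C\<close> e show ?thesis
      by (intro bexI[of _ C])
         (auto simp: emeasure_eq_measure ennreal_plus[symmetric] ennreal_less_iff simp del: ennreal_plus)
  qed
  then obtain C where C: "C \<subseteq> B" "compact C" "emeasure M B < emeasure M C + ennreal e" by blast
  have CM: "C \<in> sets M" using M C(2) by (auto intro: borel_compact)
  have "measure M B < measure M C + e"
    using C(3) e by (simp add: emeasure_eq_measure ennreal_plus[symmetric] ennreal_less_iff del: ennreal_plus)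
  moreover have "measure M (B - C) = measure M B - measure M C"
    using C(1) CM B' by (intro finite_measure_Diff) auto
  ultimately show ?thesis using that C(1,2) by simp
qed

text \<open>A countable family that separates points generates the Borel sets up to null sets. On a
  compact set of almost full measure all members of the family are relatively clopen (as in Lusin's
  theorem), so that disjoint compact sets are separated by finitely many of them. This replaces the
  measurability of the inverse of an injective Borel map.\<close>

lemma separating_sequence_approx:
  fixes M :: "'a::polish_space measure"
  assumes M: "sets M = sets borel" "finite_measure M"
    and E: "\<And>j::nat. E j \<in> sets borel" and \<Theta>: "\<Theta> \<in> sets borel"
    and sep: "\<And>x y. x \<in> \<Theta> \<Longrightarrow> y \<in> \<Theta> \<Longrightarrow> x \<noteq> y \<Longrightarrow> \<exists>j. x \<in> E j \<and> y \<notin> E j"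
    and A: "A \<in> sets borel" "A \<subseteq> \<Theta>" and \<epsilon>: "0 < \<epsilon>"
  obtains \<J> where "finite \<J>" "\<And>J. J \<in> \<J> \<Longrightarrow> finite J"
    "measure M (\<Theta> \<inter> sym_diff A (\<Union>J\<in>\<J>. \<Inter>j\<in>J. E j)) < \<epsilon>"
proof -
  interpret finite_measure M by fact
  \<comment> \<open>For each j the errors of \<open>C j\<close> and \<open>D j\<close> add up to at
    most \<epsilon>/4 * (1/2)^(j+1), so all j together cost \<epsilon>/4. The sets \<open>P0\<close>
    and \<open>Q0\<close> cost less than \<epsilon>/4 each, and the total stays below
    \<epsilon>.\<close>
  define e where "e j = \<epsilon> / 8 * (1/2) ^ Suc j" for j :: nat
  have e: "0 < e j" for j using \<epsilon> by (simp add: e_def)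
  have "\<exists>C. C \<subseteq> \<Theta> \<inter> E j \<and> compact C \<and> measure M (\<Theta> \<inter> E j - C) < e j" for j
    using compact_inner_approx[OF M, of "\<Theta> \<inter> E j" "e j"] E \<Theta> e by (metis sets.Int)
  then obtain C where C: "C j \<subseteq> \<Theta> \<inter> E j" "compact (C j)" "measure M (\<Theta> \<inter> E j - C j) < e j" for j
    by metis
  have "\<exists>D. D \<subseteq> \<Theta> - E j \<and> compact D \<and> measure M (\<Theta> - E j - D) < e j" for j
    using compact_inner_approx[OF M, of "\<Theta> - E j" "e j"] E \<Theta> e by (metis sets.Diff)
  then obtain D where D: "D j \<subseteq> \<Theta> - E j" "compact (D j)" "measure M (\<Theta> - E j - D j) < e j" for j
    by metis
  obtain P0 where P0: "P0 \<subseteq> A" "compact P0" "measure M (A - P0) < \<epsilon> / 4"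
    using compact_inner_approx[OF M, of A "\<epsilon> / 4"] A \<epsilon> by auto
  obtain Q0 where Q0: "Q0 \<subseteq> \<Theta> - A" "compact Q0" "measure M (\<Theta> - A - Q0) < \<epsilon> / 4"
    using compact_inner_approx[OF M, of "\<Theta> - A" "\<epsilon> / 4"] A \<Theta> \<epsilon> by auto
  have [measurable]: "C j \<in> sets M" "D j \<in> sets M" "P0 \<in> sets M" "Q0 \<in> sets M" "E j \<in> sets M"
    "A \<in> sets M" "\<Theta> \<in> sets M" for j
    using C D P0 Q0 E A \<Theta> M(1) by (auto intro: borel_compact)
  \<comment> \<open>On \<open>K\<close>, being in \<open>E j\<close>, being in \<open>C j\<close>
    and not being in \<open>D j\<close> are equivalent. Inside \<open>K\<close> one may thus replace
    \<open>E j\<close> by the open set \<open>- D j\<close> and its complement by the open set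
    \<open>- C j\<close>, which gives the open covers below.\<close>
  define K where "K = (\<Inter>j. C j \<union> D j)"
  have K: "compact K"
  proof -
    have "closed K" unfolding K_def using C(2) D(2) by (intro closed_INT ballI closed_Un compact_imp_closed)
    then have "compact ((C 0 \<union> D 0) \<inter> K)" using C(2) D(2) by (intro compact_Int_closed compact_Un)
    also have "(C 0 \<union> D 0) \<inter> K = K" unfolding K_def by blast
    finally show ?thesis .
  qed
  have [measurable]: "K \<in> sets M" unfolding K_def by measurable
  have small: "measure M (\<Theta> - (C j \<union> D j)) \<le> \<epsilon> / 4 * (1/2) ^ Suc j" for j
  proof -
    have "measure M (\<Theta> - (C j \<union> D j)) \<le> measure M ((\<Theta> \<inter> E j - C j) \<union> (\<Theta> - E j - D j))"
      by (rule finite_measure_mono) auto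
    also have "\<dots> \<le> measure M (\<Theta> \<inter> E j - C j) + measure M (\<Theta> - E j - D j)"
      by (rule measure_Un_le) auto
    finally show ?thesis using C(3)[of j] D(3)[of j] by (simp add: e_def)
  qed
  have sums: "(\<lambda>j. \<epsilon> / 4 * (1/2) ^ Suc j) sums (\<epsilon> / 4)"
    using sums_mult[OF power_half_series, of "\<epsilon> / 4"] by simp
  have summ: "summable (\<lambda>j. measure M (\<Theta> - (C j \<union> D j)))"
    using small by (intro summable_comparison_test'[OF sums_summable[OF sums], of 0]) auto
  have "measure M (\<Theta> - K) = measure M (\<Union>j. \<Theta> - (C j \<union> D j))"
    by (rule arg_cong[where f="measure M"]) (auto simp: K_def)
  also have "\<dots> \<le> (\<Sum>j. measure M (\<Theta> - (C j \<union> D j)))"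
    using summ by (intro finite_measure_subadditive_countably) auto
  also have "\<dots> \<le> \<epsilon> / 4"
    using suminf_le[OF small summ sums_summable[OF sums]] sums_unique[OF sums] by simp
  finally have mK: "measure M (\<Theta> - K) \<le> \<epsilon> / 4" .
  \<comment> \<open>First use of compactness, with x fixed: every y in \<open>Q0\<close> differs
    from x and so misses some \<open>E j\<close> containing x. Finitely many of these j exclude all
    of \<open>Q0 \<inter> K\<close>.\<close>
  have "\<exists>J. finite J \<and> J \<subseteq> {j. x \<in> E j} \<and> Q0 \<inter> K \<subseteq> (\<Union>j\<in>J. - C j)" if x: "x \<in> P0 \<inter> K" for x
  proof -
    have "Q0 \<inter> K \<subseteq> (\<Union>j\<in>{j. x \<in> E j}. - C j)"
    proof
      fix y assume y: "y \<in> Q0 \<inter> K"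
      then have "\<exists>j. x \<in> E j \<and> y \<notin> E j" using x P0(1) Q0(1) A(2) by (intro sep) auto
      then show "y \<in> (\<Union>j\<in>{j. x \<in> E j}. - C j)" using C(1) by blast
    qed
    then show ?thesis
      using compactE_image[of "Q0 \<inter> K" "{j. x \<in> E j}" "\<lambda>j. - C j"] K Q0(2) C(2)
      by (metis compact_Int compact_imp_closed open_Compl)
  qed
  then obtain J where J: "finite (J x)" "J x \<subseteq> {j. x \<in> E j}" "Q0 \<inter> K \<subseteq> (\<Union>j\<in>J x. - C j)"
    if "x \<in> P0 \<inter> K" for x by metis
  have op: "open (\<Inter>j\<in>J x. - D j)" if "x \<in> P0 \<inter> K" for x
    using J(1)[OF that] D(2) by (intro open_INT) (auto simp: compact_imp_closed)
  \<comment> \<open>Second use of compactness, now over x: each x lies in its own open set, since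
    \<open>D j\<close> is disjoint from \<open>E j\<close> and x is in \<open>E j\<close> for all j
    in \<open>J x\<close>.\<close>
  have "P0 \<inter> K \<subseteq> (\<Union>x\<in>P0 \<inter> K. \<Inter>j\<in>J x. - D j)"
    using J(2) D(1) by blast
  then obtain P' where P': "P' \<subseteq> P0 \<inter> K" "finite P'" "P0 \<inter> K \<subseteq> (\<Union>x\<in>P'. \<Inter>j\<in>J x. - D j)"
    using compactE_image[of "P0 \<inter> K" "P0 \<inter> K" "\<lambda>x. \<Inter>j\<in>J x. - D j"] op P0(2) K
    by (metis compact_Int)
  let ?B = "\<Union>J\<in>J ` P'. \<Inter>j\<in>J. E j"
  have PB: "P0 \<inter> K \<subseteq> ?B"
  proof
    fix z assume z: "z \<in> P0 \<inter> K"
    then obtain x where x: "x \<in> P'" "\<And>j. j \<in> J x \<Longrightarrow> z \<notin> D j" using P'(3) by blast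
    have "z \<in> E j" if "j \<in> J x" for j
      using x(2)[OF that] z C(1)[of j] unfolding K_def by blast
    with x(1) show "z \<in> ?B" by blast
  qed
  have QB: "Q0 \<inter> K \<inter> ?B = {}"
  proof (rule ccontr)
    assume "Q0 \<inter> K \<inter> ?B \<noteq> {}"
    then obtain z x where z: "z \<in> Q0 \<inter> K" "x \<in> P'" "\<And>j. j \<in> J x \<Longrightarrow> z \<in> E j" by blast
    then obtain j where "j \<in> J x" "z \<notin> C j" using J(3)[of x] P'(1) by blast
    then show False using z D(1)[of j] unfolding K_def by blast
  qed
  have "\<Theta> \<inter> sym_diff A ?B \<subseteq> (\<Theta> - K) \<union> ((A - P0) \<union> (\<Theta> - A - Q0))"
    using PB QB A(2) by blast
  then have "measure M (\<Theta> \<inter> sym_diff A ?B) \<le> measure M ((\<Theta> - K) \<union> ((A - P0) \<union> (\<Theta> - A - Q0)))"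
    by (rule finite_measure_mono) measurable
  also have "\<dots> \<le> measure M (\<Theta> - K) + measure M ((A - P0) \<union> (\<Theta> - A - Q0))"
    by (rule measure_Un_le) auto
  also have "measure M ((A - P0) \<union> (\<Theta> - A - Q0)) \<le> measure M (A - P0) + measure M (\<Theta> - A - Q0)"
    by (rule measure_Un_le) auto
  finally have "measure M (\<Theta> \<inter> sym_diff A ?B) < \<epsilon>" using mK P0(3) Q0(3) \<epsilon> by linarith
  moreover have "finite J'" if "J' \<in> J ` P'" for J' using that J(1) P'(1) by auto
  ultimately show ?thesis using that[of "J ` P'"] P'(2) by blast
qed

section \<open>Events observed in finite time\<close>

text \<open>Hoeffding's inequality for indicators of i.i.d. coordinates. Independence holds because
  the restriction of the infinite product to the first n coordinates is the product of their laws.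
  The bound does not involve the law \<open>N\<close>, so that it can later be integrated over the
  parameter.\<close>

lemma frequency_deviation:
  assumes N: "prob_space N" and U: "U \<in> sets N" and \<delta>: "0 < \<delta>" and n: "0 < n"
  shows "measure (\<Pi>\<^sub>M i\<in>UNIV. N) {\<xi> \<in> space (\<Pi>\<^sub>M i\<in>UNIV. N).
      \<delta> \<le> \<bar>(\<Sum>i<n. indicator U (\<xi> i)) / real n - measure N U\<bar>} \<le> 2 * exp (- 2 * real n * \<delta>\<^sup>2)"
proof -
  let ?M = "\<Pi>\<^sub>M i\<in>(UNIV :: nat set). N"
  interpret N: prob_space N by fact
  interpret PP: product_prob_space "\<lambda>_. N" "UNIV :: nat set" by unfold_locales
  note U[measurable]
  have comp: "distr ?M N (\<lambda>\<xi>. \<xi> i) = N" for i by (rule PP.PiM_component) simp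
  have "distr ?M (\<Pi>\<^sub>M i\<in>{..<n}. N) (\<lambda>\<xi>. \<lambda>i\<in>{..<n}. \<xi> i) = (\<Pi>\<^sub>M i\<in>{..<n}. N)"
    by (rule PP.distr_PiM_restrict_finite) auto
  then have "PP.indep_vars (\<lambda>_. N) (\<lambda>i \<xi>. \<xi> i) {..<n}"
    using n by (subst PP.indep_vars_iff_distr_eq_PiM') (auto simp: comp)
  then have ind: "PP.indep_vars (\<lambda>_. borel) (\<lambda>i \<xi>. indicator U (\<xi> i) :: real) {..<n}"
    by (rule PP.indep_vars_compose2) measurable
  have distr: "distr ?M borel (\<lambda>\<xi>. indicator U (\<xi> i) :: real) = distr N borel (indicator U)" for i
  proof -
    have "distr ?M borel (\<lambda>\<xi>. indicator U (\<xi> i) :: real) = distr (distr ?M N (\<lambda>\<xi>. \<xi> i)) borel (indicator U)"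
    proof -
      have m: "(\<lambda>\<xi>. \<xi> i) \<in> ?M \<rightarrow>\<^sub>M N" by (rule measurable_component_singleton) simp
      have m': "(indicator U :: _ \<Rightarrow> real) \<in> borel_measurable N" by (rule borel_measurable_indicator[OF U])
      show ?thesis using distr_distr[OF m' m] by (simp only: comp_def)
    qed
    then show ?thesis unfolding comp .
  qed
  interpret H: Hoeffding_ineq_iid ?M "{..<n}" "\<lambda>i \<xi>. indicator U (\<xi> i)" "\<lambda>\<xi>. indicator U (\<xi> 0)" 0 1
    "PP.expectation (\<lambda>\<xi>. indicator U (\<xi> 0))"
  proof unfold_locales
    show "distr ?M borel (\<lambda>\<xi>. indicator U (\<xi> i) :: real) = distr ?M borel (\<lambda>\<xi>. indicator U (\<xi> 0))" for i
      by (simp only: distr)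
    show "AE \<xi> in ?M. indicator U (\<xi> 0) \<in> {0..1::real}"
      by (rule AE_I2) (simp add: indicator_def)
    show "(\<lambda>\<xi>. indicator U (\<xi> 0) :: real) \<in> borel_measurable ?M" by measurable
  qed (use ind in simp_all)
  have "PP.expectation (\<lambda>\<xi>. indicator U (\<xi> 0)) = integral\<^sup>L (distr ?M N (\<lambda>\<xi>. \<xi> 0)) (indicator U :: _ \<Rightarrow> real)"
    by (rule integral_distr[symmetric]) measurable
  also have "\<dots> = measure N U" using sets.sets_into_space[OF U] by (simp add: comp Int_absorb2)
  finally have ex: "PP.expectation (\<lambda>\<xi>. indicator U (\<xi> 0)) = measure N U" .
  have "{\<xi> \<in> space ?M. \<delta> \<le> \<bar>(\<Sum>i<n. indicator U (\<xi> i)) / real n - measure N U\<bar>}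
     = {\<xi> \<in> space ?M. real n * \<delta> \<le> \<bar>(\<Sum>i<n. indicator U (\<xi> i)) - real n * measure N U\<bar>}"
  proof (intro Collect_cong conj_cong refl)
    fix \<xi>
    have "\<bar>(\<Sum>i<n. indicator U (\<xi> i)) - real n * measure N U\<bar>
        = real n * \<bar>(\<Sum>i<n. indicator U (\<xi> i)) / real n - measure N U\<bar>"
      using n by (simp add: abs_mult_pos' right_diff_distrib)
    then show "\<delta> \<le> \<bar>(\<Sum>i<n. indicator U (\<xi> i)) / real n - measure N U\<bar> \<longleftrightarrow>
        real n * \<delta> \<le> \<bar>(\<Sum>i<n. indicator U (\<xi> i)) - real n * measure N U\<bar>"
      using n by simp
  qed
  also have "measure ?M \<dots> \<le> 2 * exp (- 2 * (real n * \<delta>)\<^sup>2 / (real n * (1 - 0)\<^sup>2))"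
    using H.Hoeffding_ineq_abs_ge[of "real n * \<delta>"] n \<delta> by (auto simp: ex)
  also have "- 2 * (real n * \<delta>)\<^sup>2 / (real n * (1 - 0)\<^sup>2) = - 2 * real n * \<delta>\<^sup>2"
    using n by (simp add: power2_eq_square)
  finally show ?thesis .
qed

text \<open>The finite intersections of a countable base form a countable intersection-stable
  generator of the Borel sets. The empty intersection supplies the whole space, which bounds the
  measures in the uniqueness theorem.\<close>

lemma countable_borel_determining:
  "\<exists>\<U> :: 'a::second_countable_topology set set. countable \<U> \<and> \<U> \<subseteq> sets borel \<and>
    (\<forall>M N :: 'a measure. prob_space M \<longrightarrow> sets M = sets borel \<longrightarrow> sets N = sets borel \<longrightarrow>
      (\<forall>U\<in>\<U>. emeasure M U = emeasure N U) \<longrightarrow> M = N)"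
proof -
  obtain B :: "'a set set" where B: "countable B" "topological_basis B"
    using ex_countable_basis by blast
  define \<U> where "\<U> = Inter ` {F. finite F \<and> F \<subseteq> B}"
  have "countable \<U>" unfolding \<U>_def using B(1) by (intro countable_image countable_Collect_finite_subset)
  have op: "open U" if "U \<in> \<U>" for U
    using that topological_basis_open[OF B(2)] unfolding \<U>_def by (auto intro!: open_Inter)
  have "B \<subseteq> \<U>" unfolding \<U>_def by (auto intro!: image_eqI[of _ _ "{x}" for x])
  have sig: "sets (borel :: 'a measure) = sigma_sets UNIV \<U>"
  proof -
    have "sets (borel :: 'a measure) = sigma_sets UNIV B"
      by (simp add: borel_eq_countable_basis[OF B])
    also have "\<dots> \<subseteq> sigma_sets UNIV \<U>" using \<open>B \<subseteq> \<U>\<close> by (rule sigma_sets_mono')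
    finally have "sets (borel :: 'a measure) \<subseteq> sigma_sets UNIV \<U>" .
    moreover have "\<U> \<subseteq> sets borel" using op borel_open by blast
    then have "sigma_sets UNIV \<U> \<subseteq> sets borel"
      using sets.sigma_sets_subset[of \<U> "borel :: 'a measure"] by simp
    ultimately show ?thesis by (rule equalityI)
  qed
  have "Int_stable \<U>"
  proof (rule Int_stableI)
    fix a b assume "a \<in> \<U>" "b \<in> \<U>"
    then obtain F G where "finite F" "F \<subseteq> B" "a = \<Inter>F" "finite G" "G \<subseteq> B" "b = \<Inter>G"
      unfolding \<U>_def by auto
    then show "a \<inter> b \<in> \<U>"
      unfolding \<U>_def by (auto intro!: image_eqI[of _ _ "F \<union> G"])
  qed
  have "UNIV \<in> \<U>" unfolding \<U>_def by (auto intro!: image_eqI[of _ _ "{}"])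
  have "M = N" if M: "prob_space M" and s: "sets M = sets borel" "sets N = sets borel"
    and eq: "\<forall>U\<in>\<U>. emeasure M U = emeasure N U" for M N :: "'a measure"
  proof (rule measure_eqI_generator_eq[OF \<open>Int_stable \<U>\<close>, of UNIV _ _ "\<lambda>_. UNIV"])
    interpret prob_space M by fact
    show "emeasure M UNIV \<noteq> \<infinity>" by (simp add: emeasure_eq_measure)
  qed (use eq s sig \<open>UNIV \<in> \<U>\<close> in auto)
  moreover have "\<U> \<subseteq> sets borel" using op borel_open by blast
  ultimately show ?thesis using \<open>countable \<U>\<close>
    by (intro exI[of _ \<U>] conjI allI impI) simp_all
qed

text \<open>The parameter space is Polish for the sake of inner regularity, the observation space
  second countable for the sake of a countable determining class.\<close>

locale bayesian_model =
  fixes \<Theta> :: "'t::polish_space set" and \<Xi> :: "'x::second_countable_topology set"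
    and \<pi> :: "'t measure" and P :: "'t \<Rightarrow> 'x measure" and \<mu> :: "('t \<times> (nat \<Rightarrow> 'x)) measure"
  assumes prior: "prob_space \<pi>" "sets \<pi> = sets (borel_on \<Theta>)"
    and \<Theta>_borel: "\<Theta> \<in> sets borel"
    and family: "\<And>\<theta>. \<theta> \<in> \<Theta> \<Longrightarrow> prob_space (P \<theta>)" "\<And>\<theta>. \<theta> \<in> \<Theta> \<Longrightarrow> sets (P \<theta>) = sets (borel_on \<Xi>)"
    and family_measurable:
      "\<And>B. B \<in> sets (seq_algebra \<Xi>) \<Longrightarrow> (\<lambda>\<theta>. emeasure (seq_law P \<theta>) B) \<in> borel_measurable (borel_on \<Theta>)"
    and joint: "is_joint_law \<Theta> \<Xi> \<pi> P \<mu>"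
    and identifiable: "\<And>\<theta>\<^sub>1 \<theta>\<^sub>2. \<theta>\<^sub>1 \<in> \<Theta> \<Longrightarrow> \<theta>\<^sub>2 \<in> \<Theta> \<Longrightarrow> \<theta>\<^sub>1 \<noteq> \<theta>\<^sub>2 \<Longrightarrow>
      \<exists>A\<in>sets (seq_algebra \<Xi>). emeasure (seq_law P \<theta>\<^sub>1) A \<noteq> emeasure (seq_law P \<theta>\<^sub>2) A"
begin

sublocale prior: prob_space \<pi> by (rule prior)

sublocale joint: prob_space \<mu> using joint by (simp add: is_joint_law_def)

abbreviation F where "F \<equiv> obs_algebra \<Xi> \<mu>"

lemma space_\<pi>: "space \<pi> = \<Theta>"
  using sets_eq_imp_space_eq[OF prior(2)] by (simp add: space_restrict_space)

lemma sets_\<mu>[measurable_cong]: "sets \<mu> = sets (borel_on \<Theta> \<Otimes>\<^sub>M seq_algebra \<Xi>)"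
  using joint by (simp add: is_joint_law_def)

lemma space_seq_algebra: "space (seq_algebra \<Xi>) = (\<Pi>\<^sub>E i\<in>UNIV. \<Xi>)"
  by (simp add: seq_algebra_def space_PiM space_restrict_space)

lemma space_\<mu>: "space \<mu> = \<Theta> \<times> (\<Pi>\<^sub>E i\<in>UNIV. \<Xi>)"
  using sets_eq_imp_space_eq[OF sets_\<mu>] by (simp add: space_pair_measure space_restrict_space space_seq_algebra)

lemma fst_measurable: "fst \<in> \<mu> \<rightarrow>\<^sub>M borel_on \<Theta>"
  by measurable

lemma observation_measurable: "observation i \<in> \<mu> \<rightarrow>\<^sub>M borel_on \<Xi>"
  unfolding observation_def seq_algebra_def
  by (subst measurable_cong_sets[OF sets_\<mu> refl]) (auto simp: seq_algebra_def)

lemma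
  assumes "\<theta> \<in> \<Theta>"
  shows prob_space_seq_law: "prob_space (seq_law P \<theta>)"
    and sets_seq_law: "sets (seq_law P \<theta>) = sets (seq_algebra \<Xi>)"
  using family[OF assms] unfolding seq_law_def seq_algebra_def
  by (auto intro!: prob_space_PiM sets_PiM_cong)

section \<open>Disintegration of the joint law over the parameter\<close>

lemma seq_law_kernel: "seq_law P \<in> \<pi> \<rightarrow>\<^sub>M subprob_algebra (seq_algebra \<Xi>)"
  using prior(2)
  by (intro measurable_subprob_algebra)
     (auto simp: space_\<pi> sets_seq_law prob_space_seq_law prob_space_imp_subprob_space
        measurable_cong_sets[OF prior(2) refl] family_measurable)

text \<open>The rectangles, on which \<mu> is prescribed, are an intersection-stable generator.
  Written as a mixture, \<mu> can be evaluated on events coupling parameter and data, such as a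
  deviation of a frequency from the true probability.\<close>

lemma joint_eq_bind:
  "\<mu> = \<pi> \<bind> (\<lambda>\<theta>. distr (seq_law P \<theta>) (borel_on \<Theta> \<Otimes>\<^sub>M seq_algebra \<Xi>) (Pair \<theta>))" (is "_ = \<pi> \<bind> ?K")
  and joint_kernel:
  "(\<lambda>\<theta>. distr (seq_law P \<theta>) (borel_on \<Theta> \<Otimes>\<^sub>M seq_algebra \<Xi>) (Pair \<theta>)) \<in>
    \<pi> \<rightarrow>\<^sub>M subprob_algebra (borel_on \<Theta> \<Otimes>\<^sub>M seq_algebra \<Xi>)"
proof -
  let ?N = "borel_on \<Theta> \<Otimes>\<^sub>M seq_algebra \<Xi>"
  note [measurable_cong] = prior(2)
  show K: "?K \<in> \<pi> \<rightarrow>\<^sub>M subprob_algebra ?N"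
    by (rule measurable_distr2[OF _ seq_law_kernel]) measurable
  let ?G = "{a \<times> b |a b. a \<in> sets (borel_on \<Theta>) \<and> b \<in> sets (seq_algebra \<Xi>)}"
  show "\<mu> = \<pi> \<bind> ?K"
  proof (rule measure_eqI_generator_eq[where E="?G" and \<Omega>="space (borel_on \<Theta>) \<times> space (seq_algebra \<Xi>)"
        and A="\<lambda>_. space (borel_on \<Theta>) \<times> space (seq_algebra \<Xi>)"])
    show "Int_stable ?G" by (rule Int_stable_pair_measure_generator)
    show "?G \<subseteq> Pow (space (borel_on \<Theta>) \<times> space (seq_algebra \<Xi>))"
      by (rule pair_measure_closed)
    show "sets \<mu> = sigma_sets (space (borel_on \<Theta>) \<times> space (seq_algebra \<Xi>)) ?G"
      unfolding sets_\<mu> by (rule sets_pair_measure)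
    show "sets (\<pi> \<bind> ?K) = sigma_sets (space (borel_on \<Theta>) \<times> space (seq_algebra \<Xi>)) ?G"
      using sets_bind_measurable[OF K prior.not_empty] sets_pair_measure[of "borel_on \<Theta>" "seq_algebra \<Xi>"] by simp
    show "emeasure \<mu> Z \<noteq> \<infinity>" for Z by (simp add: joint.emeasure_eq_measure)
    fix Z assume "Z \<in> ?G"
    then obtain A B where Z: "Z = A \<times> B" and A: "A \<in> sets (borel_on \<Theta>)" and B: "B \<in> sets (seq_algebra \<Xi>)"
      by auto
    have Zm: "Z \<in> sets ?N" using A B Z by simp
    have "emeasure (\<pi> \<bind> ?K) Z = (\<integral>\<^sup>+\<theta>. emeasure (?K \<theta>) Z \<partial>\<pi>)"
      by (rule emeasure_bind[OF prior.not_empty K Zm])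
    also have "\<dots> = (\<integral>\<^sup>+\<theta>\<in>A. emeasure (seq_law P \<theta>) B \<partial>\<pi>)"
    proof (rule nn_integral_cong)
      fix \<theta> assume "\<theta> \<in> space \<pi>"
      then have \<theta>: "\<theta> \<in> \<Theta>" by (simp add: space_\<pi>)
      have "Pair \<theta> \<in> seq_law P \<theta> \<rightarrow>\<^sub>M ?N"
        using \<theta> by (subst measurable_cong_sets[OF sets_seq_law[OF \<theta>] refl])
          (auto intro!: measurable_Pair1' simp: space_restrict_space)
      moreover have "Pair \<theta> -` Z \<inter> space (seq_law P \<theta>) = (if \<theta> \<in> A then B else {})"
        using sets.sets_into_space[OF B] sets_eq_imp_space_eq[OF sets_seq_law[OF \<theta>]] by (auto simp: Z)
      ultimately show "emeasure (?K \<theta>) Z = emeasure (seq_law P \<theta>) B * indicator A \<theta>"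
        using Zm by (simp add: emeasure_distr)
    qed
    also have "\<dots> = emeasure \<mu> Z" using joint A B by (simp add: is_joint_law_def Z)
    finally show "emeasure \<mu> Z = emeasure (\<pi> \<bind> ?K) Z" by simp
  qed auto
qed

lemma emeasure_joint:
  assumes C: "C \<in> sets \<mu>"
  shows "emeasure \<mu> C = (\<integral>\<^sup>+\<theta>. emeasure (seq_law P \<theta>) {\<xi> \<in> space (seq_algebra \<Xi>). (\<theta>, \<xi>) \<in> C} \<partial>\<pi>)"
proof -
  let ?N = "borel_on \<Theta> \<Otimes>\<^sub>M seq_algebra \<Xi>"
  have C': "C \<in> sets ?N" using C sets_\<mu> by simp
  have "emeasure \<mu> C = (\<integral>\<^sup>+\<theta>. emeasure (distr (seq_law P \<theta>) ?N (Pair \<theta>)) C \<partial>\<pi>)"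
    by (subst joint_eq_bind) (rule emeasure_bind[OF prior.not_empty joint_kernel C'])
  also have "\<dots> = (\<integral>\<^sup>+\<theta>. emeasure (seq_law P \<theta>) {\<xi> \<in> space (seq_algebra \<Xi>). (\<theta>, \<xi>) \<in> C} \<partial>\<pi>)"
  proof (rule nn_integral_cong)
    fix \<theta> assume "\<theta> \<in> space \<pi>"
    then have \<theta>: "\<theta> \<in> \<Theta>" by (simp add: space_\<pi>)
    have "Pair \<theta> \<in> seq_law P \<theta> \<rightarrow>\<^sub>M ?N"
      using \<theta> by (subst measurable_cong_sets[OF sets_seq_law[OF \<theta>] refl])
        (auto intro!: measurable_Pair1' simp: space_restrict_space)
    moreover have "Pair \<theta> -` C \<inter> space (seq_law P \<theta>) = {\<xi> \<in> space (seq_algebra \<Xi>). (\<theta>, \<xi>) \<in> C}"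
      using sets_eq_imp_space_eq[OF sets_seq_law[OF \<theta>]] by auto
    ultimately show "emeasure (distr (seq_law P \<theta>) ?N (Pair \<theta>)) C
        = emeasure (seq_law P \<theta>) {\<xi> \<in> space (seq_algebra \<Xi>). (\<theta>, \<xi>) \<in> C}"
      by (simp add: emeasure_distr[OF _ C'])
  qed
  finally show ?thesis .
qed

lemma emeasure_parameter:
  assumes A: "A \<in> sets (borel_on \<Theta>)"
  shows "emeasure \<mu> {\<omega> \<in> space \<mu>. fst \<omega> \<in> A} = emeasure \<pi> A"
proof -
  have "{\<omega> \<in> space \<mu>. fst \<omega> \<in> A} = A \<times> space (seq_algebra \<Xi>)"
    using sets.sets_into_space[OF A] by (auto simp: space_\<mu> space_seq_algebra space_restrict_space)
  also have "emeasure \<mu> \<dots> = (\<integral>\<^sup>+\<theta>\<in>A. emeasure (seq_law P \<theta>) (space (seq_algebra \<Xi>)) \<partial>\<pi>)"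
    using joint A by (simp add: is_joint_law_def)
  also have "\<dots> = (\<integral>\<^sup>+\<theta>. indicator A \<theta> \<partial>\<pi>)"
  proof (rule nn_integral_cong)
    fix \<theta> assume "\<theta> \<in> space \<pi>"
    then have \<theta>: "\<theta> \<in> \<Theta>" by (simp add: space_\<pi>)
    interpret prob_space "seq_law P \<theta>" by (rule prob_space_seq_law[OF \<theta>])
    show "emeasure (seq_law P \<theta>) (space (seq_algebra \<Xi>)) * indicator A \<theta> = indicator A \<theta>"
      using emeasure_space_1 sets_eq_imp_space_eq[OF sets_seq_law[OF \<theta>]] by simp
  qed
  also have "\<dots> = emeasure \<pi> A" using A prior(2) by simp
  finally show ?thesis .
qed

text \<open>Measurability is postulated for the laws of whole sequences. The probability of
  \<open>U\<close> is the sequence law of the cylinder over the first coordinate.\<close>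

lemma probability_measurable:
  assumes U: "U \<in> sets (borel_on \<Xi>)"
  shows "(\<lambda>\<theta>. measure (P \<theta>) U) \<in> borel_measurable (borel_on \<Theta>)"
proof -
  let ?C = "{\<xi> \<in> space (seq_algebra \<Xi>). \<xi> 0 \<in> U}"
  have C: "?C \<in> sets (seq_algebra \<Xi>)"
    unfolding seq_algebra_def using U by measurable
  have "emeasure (seq_law P \<theta>) ?C = emeasure (P \<theta>) U" if \<theta>: "\<theta> \<in> \<Theta>" for \<theta>
  proof -
    have "P \<theta> = distr (seq_law P \<theta>) (P \<theta>) (\<lambda>\<xi>. \<xi> 0)"
      unfolding seq_law_def using family[OF \<theta>] by (intro distr_PiM_component[symmetric]) auto
    then have "emeasure (P \<theta>) U = emeasure (distr (seq_law P \<theta>) (P \<theta>) (\<lambda>\<xi>. \<xi> 0)) U" by simp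
    also have "\<dots> = emeasure (seq_law P \<theta>) ((\<lambda>\<xi>. \<xi> 0) -` U \<inter> space (seq_law P \<theta>))"
      using U family[OF \<theta>] by (intro emeasure_distr) (auto simp: seq_law_def)
    also have "(\<lambda>\<xi>. \<xi> 0) -` U \<inter> space (seq_law P \<theta>) = ?C"
      using sets_eq_imp_space_eq[OF sets_seq_law[OF \<theta>]] by auto
    finally show ?thesis ..
  qed
  then have "(\<lambda>\<theta>. enn2real (emeasure (seq_law P \<theta>) ?C)) \<in> borel_measurable (borel_on \<Theta>) \<longleftrightarrow> ?thesis"
    by (intro measurable_cong) (auto simp: measure_def space_restrict_space)
  moreover have "(\<lambda>\<theta>. enn2real (emeasure (seq_law P \<theta>) ?C)) \<in> borel_measurable (borel_on \<Theta>)"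
    using family_measurable[OF C] by measurable
  ultimately show ?thesis by simp
qed

section \<open>Finite-time observations and empirical frequencies\<close>

lemma space_F[simp]: "space (F n) = space \<mu>"
  unfolding obs_algebra_def by (rule space_measure_of) auto

lemma sets_F: "sets (F n) = sigma_sets (space \<mu>) {observation i -` A \<inter> space \<mu> |i A. i < n \<and> A \<in> sets (borel_on \<Xi>)}"
  unfolding obs_algebra_def by (rule sets_measure_of) auto

lemma observation_measurable_F:
  assumes "i < n"
  shows "observation i \<in> F n \<rightarrow>\<^sub>M borel_on \<Xi>"
proof (rule measurableI)
  show "observation i \<omega> \<in> space (borel_on \<Xi>)" if "\<omega> \<in> space (F n)" for \<omega>
    using that by (auto simp: observation_def space_\<mu> space_restrict_space PiE_iff)
  show "observation i -` A \<inter> space (F n) \<in> sets (F n)" if "A \<in> sets (borel_on \<Xi>)" for A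
    using that assms unfolding sets_F by (auto intro!: sigma_sets.Basic)
qed

lemma F_mono: "m \<le> n \<Longrightarrow> sets (F m) \<subseteq> sets (F n)"
  unfolding sets_F by (intro sigma_sets_mono') fastforce

lemma F_subset: "sets (F n) \<subseteq> sets \<mu>"
  unfolding sets_F using observation_measurable
  by (intro sets.sigma_sets_subset) (auto intro: measurable_sets)

lemma F_subalgebra: "subalgebra \<mu> (F n)"
  using F_subset by (simp add: subalgebra_def)

definition freq :: "nat \<Rightarrow> 'x set \<Rightarrow> 't \<times> (nat \<Rightarrow> 'x) \<Rightarrow> real" where
  "freq n U \<omega> = (\<Sum>i<n. indicator U (snd \<omega> i)) / real n"

lemma freq_measurable:
  assumes "U \<in> sets (borel_on \<Xi>)"
  shows "freq n U \<in> borel_measurable (F n)"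
proof -
  have "(\<lambda>\<omega>. indicator U (observation i \<omega>) :: real) \<in> borel_measurable (F n)" if "i < n" for i
    using observation_measurable_F[OF that] assms by measurable
  then have "(\<lambda>\<omega>. (\<Sum>i<n. indicator U (observation i \<omega>)) / real n) \<in> borel_measurable (F n)"
    by (intro borel_measurable_divide borel_measurable_sum) auto
  then show ?thesis by (simp add: freq_def[abs_def] observation_def)
qed

text \<open>For each fixed parameter this is \<open>frequency_deviation\<close>; its bound is
  constant in \<theta> and survives integration over the prior.\<close>

lemma measure_freq_deviation:
  assumes U: "U \<in> sets (borel_on \<Xi>)" and \<delta>: "0 < \<delta>" and n: "0 < n"
  shows "measure \<mu> {\<omega> \<in> space \<mu>. \<delta> \<le> \<bar>freq n U \<omega> - measure (P (fst \<omega>)) U\<bar>} \<le> 2 * exp (- 2 * real n * \<delta>\<^sup>2)"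
    (is "measure \<mu> ?C \<le> ?b")
proof -
  have [measurable]: "freq n U \<in> borel_measurable \<mu>"
    using freq_measurable[OF U] by (rule measurable_from_subalg[OF F_subalgebra])
  have [measurable]: "(\<lambda>\<omega>. measure (P (fst \<omega>)) U) \<in> borel_measurable \<mu>"
    using measurable_compose[OF fst_measurable probability_measurable[OF U]] .
  have C: "?C \<in> sets \<mu>" by measurable
  have "emeasure \<mu> ?C = (\<integral>\<^sup>+\<theta>. emeasure (seq_law P \<theta>) {\<xi> \<in> space (seq_algebra \<Xi>). (\<theta>, \<xi>) \<in> ?C} \<partial>\<pi>)"
    by (rule emeasure_joint[OF C])
  also have "\<dots> \<le> (\<integral>\<^sup>+\<theta>. ennreal ?b \<partial>\<pi>)"
  proof (rule nn_integral_mono)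
    fix \<theta> assume "\<theta> \<in> space \<pi>"
    then have \<theta>: "\<theta> \<in> \<Theta>" by (simp add: space_\<pi>)
    interpret prob_space "seq_law P \<theta>" by (rule prob_space_seq_law[OF \<theta>])
    have "{\<xi> \<in> space (seq_algebra \<Xi>). (\<theta>, \<xi>) \<in> ?C}
       = {\<xi> \<in> space (seq_law P \<theta>). \<delta> \<le> \<bar>(\<Sum>i<n. indicator U (\<xi> i)) / real n - measure (P \<theta>) U\<bar>}"
      using \<theta> sets_eq_imp_space_eq[OF sets_seq_law[OF \<theta>]] by (auto simp: space_\<mu> space_seq_algebra freq_def)
    moreover have "measure (seq_law P \<theta>) \<dots> \<le> ?b"
      unfolding seq_law_def using family[OF \<theta>] U \<delta> n by (intro frequency_deviation) auto
    ultimately show "emeasure (seq_law P \<theta>) {\<xi> \<in> space (seq_algebra \<Xi>). (\<theta>, \<xi>) \<in> ?C} \<le> ennreal ?b"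
      by (simp add: emeasure_eq_measure)
  qed
  also have "\<dots> = ennreal ?b" by (simp add: prior.emeasure_space_1)
  finally show ?thesis by (simp add: joint.emeasure_eq_measure)
qed

text \<open>As the \<open>F n\<close> increase, these are the events that agree up to a null set
  with an event of the \<sigma>-algebra generated by all observations. The definition by finite-time
  approximation avoids that \<sigma>-algebra and delivers exactly what the maximal inequality
  consumes.\<close>

definition asymptotically_observable :: "('t \<times> (nat \<Rightarrow> 'x)) set \<Rightarrow> bool" where
  "asymptotically_observable C \<longleftrightarrow>
    C \<in> sets \<mu> \<and> (\<forall>\<epsilon>>0. \<exists>n. \<exists>B\<in>sets (F n). measure \<mu> (sym_diff C B) < \<epsilon>)"

lemma asymptotically_observable_sets: "asymptotically_observable C \<Longrightarrow> C \<in> sets \<mu>"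
  by (simp add: asymptotically_observable_def)

lemma asymptotically_observable_Compl:
  assumes "asymptotically_observable C"
  shows "asymptotically_observable (space \<mu> - C)"
  unfolding asymptotically_observable_def
proof (intro conjI allI impI)
  show "space \<mu> - C \<in> sets \<mu>" using asymptotically_observable_sets[OF assms] by simp
  fix \<epsilon> :: real assume "0 < \<epsilon>"
  then obtain n B where B: "B \<in> sets (F n)" "measure \<mu> (sym_diff C B) < \<epsilon>"
    using assms by (auto simp: asymptotically_observable_def)
  have "C \<subseteq> space \<mu>" "B \<subseteq> space \<mu>"
    using sets.sets_into_space[OF asymptotically_observable_sets[OF assms]] sets.sets_into_space[OF B(1)] by simp_all
  then have "sym_diff (space \<mu> - C) (space \<mu> - B) = sym_diff C B" by blast
  moreover have "space \<mu> - B \<in> sets (F n)" using sets.compl_sets[OF B(1)] by simp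
  ultimately show "\<exists>n. \<exists>B\<in>sets (F n). measure \<mu> (sym_diff (space \<mu> - C) B) < \<epsilon>" using B(2) by metis
qed

lemma asymptotically_observable_Int:
  assumes C: "asymptotically_observable C" and D: "asymptotically_observable D"
  shows "asymptotically_observable (C \<inter> D)"
  unfolding asymptotically_observable_def
proof (intro conjI allI impI)
  note [measurable] = C[THEN asymptotically_observable_sets] D[THEN asymptotically_observable_sets]
  show "C \<inter> D \<in> sets \<mu>" by measurable
  fix \<epsilon> :: real assume "0 < \<epsilon>"
  then have "0 < \<epsilon> / 2" by simp
  obtain m A where A: "A \<in> sets (F m)" "measure \<mu> (sym_diff C A) < \<epsilon> / 2"
    using C \<open>0 < \<epsilon> / 2\<close> unfolding asymptotically_observable_def by blast
  obtain n B where B: "B \<in> sets (F n)" "measure \<mu> (sym_diff D B) < \<epsilon> / 2"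
    using D \<open>0 < \<epsilon> / 2\<close> unfolding asymptotically_observable_def by blast
  have [measurable]: "A \<in> sets \<mu>" "B \<in> sets \<mu>" using A(1) B(1) F_subset by blast+
  have "A \<inter> B \<in> sets (F (max m n))"
    using A(1) B(1) F_mono[of m "max m n"] F_mono[of n "max m n"] by (intro sets.Int) auto
  moreover have "measure \<mu> (sym_diff (C \<inter> D) (A \<inter> B)) < \<epsilon>"
  proof -
    have "measure \<mu> (sym_diff (C \<inter> D) (A \<inter> B)) \<le> measure \<mu> (sym_diff C A \<union> sym_diff D B)"
      by (rule joint.finite_measure_mono) auto
    also have "\<dots> \<le> measure \<mu> (sym_diff C A) + measure \<mu> (sym_diff D B)"
      by (rule measure_Un_le) auto
    finally show ?thesis using A(2) B(2) by simp
  qed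
  ultimately show "\<exists>n. \<exists>B\<in>sets (F n). measure \<mu> (sym_diff (C \<inter> D) B) < \<epsilon>" by blast
qed

lemma asymptotically_observable_F:
  assumes "B \<in> sets (F n)"
  shows "asymptotically_observable B"
  unfolding asymptotically_observable_def
proof (intro conjI allI impI)
  show "\<exists>n. \<exists>C\<in>sets (F n). measure \<mu> (sym_diff B C) < \<epsilon>" if "0 < \<epsilon>" for \<epsilon>
    using assms that by (intro exI[of _ n] bexI[of _ B]) auto
qed (use assms F_subset in blast)

lemma asymptotically_observable_INT:
  assumes "finite J" "\<And>j. j \<in> J \<Longrightarrow> asymptotically_observable (C j)"
  shows "asymptotically_observable {\<omega> \<in> space \<mu>. \<forall>j\<in>J. \<omega> \<in> C j}"
  using assms
proof (induction J)
  case empty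
  show ?case using asymptotically_observable_F[OF sets.top[of "F 0"]] by simp
next
  case (insert i J)
  have "C i \<subseteq> space \<mu>" using sets.sets_into_space[OF asymptotically_observable_sets] insert by blast
  then have "{\<omega> \<in> space \<mu>. \<forall>j\<in>insert i J. \<omega> \<in> C j} = C i \<inter> {\<omega> \<in> space \<mu>. \<forall>j\<in>J. \<omega> \<in> C j}" by auto
  then show ?case using insert by (simp add: asymptotically_observable_Int)
qed

lemma asymptotically_observable_UN:
  assumes "finite J" "\<And>j. j \<in> J \<Longrightarrow> asymptotically_observable (C j)"
  shows "asymptotically_observable {\<omega> \<in> space \<mu>. \<exists>j\<in>J. \<omega> \<in> C j}"
proof -
  have "asymptotically_observable (space \<mu> - {\<omega> \<in> space \<mu>. \<forall>j\<in>J. \<omega> \<in> space \<mu> - C j})"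
    using assms by (intro asymptotically_observable_Compl asymptotically_observable_INT)
  also have "space \<mu> - {\<omega> \<in> space \<mu>. \<forall>j\<in>J. \<omega> \<in> space \<mu> - C j} = {\<omega> \<in> space \<mu>. \<exists>j\<in>J. \<omega> \<in> C j}" by auto
  finally show ?thesis .
qed

lemma asymptotically_observable_limit:
  assumes C: "C \<in> sets \<mu>"
    and approx: "\<And>\<epsilon>. 0 < \<epsilon> \<Longrightarrow> \<exists>D. asymptotically_observable D \<and> measure \<mu> (sym_diff C D) < \<epsilon>"
  shows "asymptotically_observable C"
  unfolding asymptotically_observable_def
proof (intro conjI allI impI C)
  fix \<epsilon> :: real assume "0 < \<epsilon>"
  then have \<epsilon>: "0 < \<epsilon> / 2" by simp
  obtain D where D: "asymptotically_observable D" "measure \<mu> (sym_diff C D) < \<epsilon> / 2"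
    using approx[OF \<epsilon>] by blast
  then obtain n B where B: "B \<in> sets (F n)" "measure \<mu> (sym_diff D B) < \<epsilon> / 2"
    using \<epsilon> unfolding asymptotically_observable_def by blast
  have "B \<in> sets \<mu>" using B(1) F_subset by blast
  note [measurable] = this C D(1)[THEN asymptotically_observable_sets]
  have "measure \<mu> (sym_diff C B) \<le> measure \<mu> (sym_diff C D \<union> sym_diff D B)"
    by (rule joint.finite_measure_mono) auto
  also have "\<dots> \<le> measure \<mu> (sym_diff C D) + measure \<mu> (sym_diff D B)"
    by (rule measure_Un_le) auto
  finally have "measure \<mu> (sym_diff C B) < \<epsilon>" using B(2) D(2) by simp
  with B(1) show "\<exists>n. \<exists>B\<in>sets (F n). measure \<mu> (sym_diff C B) < \<epsilon>" by blast
qed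

text \<open>The shift by \<open>\<delta>\<close> of the empirical threshold is needed because \<open>measure (P \<theta>) U\<close> may equal
  \<open>q\<close> with positive prior probability.\<close>

lemma asymptotically_observable_superlevel:
  assumes U: "U \<in> sets (borel_on \<Xi>)"
  shows "asymptotically_observable {\<omega> \<in> space \<mu>. q < measure (P (fst \<omega>)) U}"
  unfolding asymptotically_observable_def
proof (intro conjI allI impI)
  let ?p = "\<lambda>\<omega>. measure (P (fst \<omega>)) U"
  have [measurable]: "freq n U \<in> borel_measurable \<mu>" for n
    using freq_measurable[OF U] by (rule measurable_from_subalg[OF F_subalgebra])
  have [measurable]: "?p \<in> borel_measurable \<mu>"
    using measurable_compose[OF fst_measurable probability_measurable[OF U]] .
  show "{\<omega> \<in> space \<mu>. q < ?p \<omega>} \<in> sets \<mu>" by measurable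
  fix \<epsilon> :: real assume \<epsilon>: "0 < \<epsilon>"
  \<comment> \<open>These slabs just above the level decrease to the empty set, because the
    inequality q < p is strict. One of them is therefore small, and its index fixes
    \<delta>.\<close>
  define A where "A k = {\<omega> \<in> space \<mu>. q < ?p \<omega> \<and> ?p \<omega> \<le> q + 2 * inverse (real (Suc k))}" for k
  have [measurable]: "A k \<in> sets \<mu>" for k unfolding A_def by measurable
  have "decseq A"
  proof (rule decseq_SucI)
    fix k
    have "inverse (real (Suc (Suc k))) \<le> inverse (real (Suc k))" by (rule le_imp_inverse_le) auto
    then have "q + 2 * inverse (real (Suc (Suc k))) \<le> q + 2 * inverse (real (Suc k))" by simp
    from order_trans[OF _ this] show "A (Suc k) \<subseteq> A k" unfolding A_def by blast
  qed
  then have "(\<lambda>k. measure \<mu> (A k)) \<longlonglongrightarrow> measure \<mu> (\<Inter>k. A k)"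
    by (intro joint.finite_Lim_measure_decseq) auto
  also have "(\<Inter>k. A k) = {}"
  proof (rule ccontr)
    assume "(\<Inter>k. A k) \<noteq> {}"
    then obtain \<omega> where \<omega>: "\<And>k. \<omega> \<in> A k" by blast
    then have pos: "0 < (?p \<omega> - q) / 2" by (auto simp: A_def)
    obtain k where "inverse (real (Suc k)) < (?p \<omega> - q) / 2" using reals_Archimedean[OF pos] by blast
    then show False using \<omega>[of k] by (auto simp: A_def)
  qed
  finally have "(\<lambda>k. measure \<mu> (A k)) \<longlonglongrightarrow> 0" by simp
  then have "\<forall>\<^sub>F k in sequentially. measure \<mu> (A k) < \<epsilon> / 2"
    using \<epsilon> by (intro order_tendstoD) auto
  then obtain k where k: "measure \<mu> (A k) < \<epsilon> / 2" using eventually_happens'[OF sequentially_bot] by blast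
  define \<delta> where "\<delta> = inverse (real (Suc k))"
  have \<delta>: "0 < \<delta>" by (simp add: \<delta>_def)
  have Ak: "A k = {\<omega> \<in> space \<mu>. q < ?p \<omega> \<and> ?p \<omega> \<le> q + 2 * \<delta>}"
    by (simp add: A_def \<delta>_def)
  have "(\<lambda>n. 2 * exp (- 2 * real n * \<delta>\<^sup>2)) \<longlonglongrightarrow> 0"
    using \<delta> by real_asymp
  then have "\<forall>\<^sub>F n in sequentially. 0 < n \<and> 2 * exp (- 2 * real n * \<delta>\<^sup>2) < \<epsilon> / 2"
    using \<epsilon> by (intro eventually_conj eventually_gt_at_top order_tendstoD(2)[of _ 0]) auto
  then obtain n where n: "0 < n" "2 * exp (- 2 * real n * \<delta>\<^sup>2) < \<epsilon> / 2"
    using eventually_happens'[OF sequentially_bot] by blast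
  let ?B = "{\<omega> \<in> space \<mu>. q + \<delta> < freq n U \<omega>}"
  let ?D = "{\<omega> \<in> space \<mu>. \<delta> \<le> \<bar>freq n U \<omega> - ?p \<omega>\<bar>}"
  \<comment> \<open>If frequency and probability p differ by less than \<delta>, then p > q + 2 *
    \<delta> forces the frequency above q + \<delta> and p \<le> q keeps it below. Only the slab in
    between can be misjudged.\<close>
  have "measure \<mu> (sym_diff {\<omega> \<in> space \<mu>. q < ?p \<omega>} ?B) \<le> measure \<mu> (A k \<union> ?D)"
    by (rule joint.finite_measure_mono) (auto simp: Ak)
  also have "\<dots> \<le> measure \<mu> (A k) + measure \<mu> ?D"
    by (rule measure_Un_le) auto
  also have "\<dots> < \<epsilon>" using k n measure_freq_deviation[OF U \<delta> n(1)] by linarith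
  finally have "measure \<mu> (sym_diff {\<omega> \<in> space \<mu>. q < ?p \<omega>} ?B) < \<epsilon>" .
  moreover have "?B \<in> sets (F n)"
  proof -
    note freq_measurable[OF U, of n, measurable]
    have "{\<omega> \<in> space (F n). q + \<delta> < freq n U \<omega>} \<in> sets (F n)" by measurable
    then show ?thesis by simp
  qed
  ultimately show "\<exists>n. \<exists>B\<in>sets (F n). measure \<mu> (sym_diff {\<omega> \<in> space \<mu>. q < ?p \<omega>} B) < \<epsilon>" by blast
qed

text \<open>Two parameters whose observation laws agree on the countable determining class have the
  same observation law, hence the same sequence law, which identifiability excludes. A rational
  level between two different probabilities then separates the parameters.\<close>

lemma separating_sequence:
  obtains E :: "nat \<Rightarrow> 't set" where "\<And>j. E j \<in> sets (borel_on \<Theta>)"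
    "\<And>j. asymptotically_observable {\<omega> \<in> space \<mu>. fst \<omega> \<in> E j}"
    "\<And>x y. x \<in> \<Theta> \<Longrightarrow> y \<in> \<Theta> \<Longrightarrow> x \<noteq> y \<Longrightarrow> \<exists>j. x \<in> E j \<and> y \<notin> E j"
proof -
  obtain \<U> :: "'x set set" where \<U>: "countable \<U>" "\<U> \<subseteq> sets borel"
    and \<U>_eqI: "\<And>M N :: 'x measure. prob_space M \<Longrightarrow> sets M = sets borel \<Longrightarrow> sets N = sets borel \<Longrightarrow>
      \<forall>U\<in>\<U>. emeasure M U = emeasure N U \<Longrightarrow> M = N"
    using countable_borel_determining[where 'a='x] by blast
  let ?p = "\<lambda>U \<theta>. measure (P \<theta>) (\<Xi> \<inter> U)"
  define G where "G U q = {\<theta> \<in> \<Theta>. q < ?p U \<theta>}" for U q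
  \<comment> \<open>Separation is directed: a set must contain x and miss y. Since either of the two
    probabilities may be the larger one, complements are included.\<close>
  define \<E> where "\<E> = case_prod G ` (\<U> \<times> \<rat>) \<union> (-) \<Theta> ` case_prod G ` (\<U> \<times> \<rat>)"
  have "countable \<E>" unfolding \<E>_def using \<U>(1) countable_rat by auto
  have U: "\<Xi> \<inter> U \<in> sets (borel_on \<Xi>)" if "U \<in> \<U>" for U
    using that \<U>(2) by (auto simp: sets_restrict_space)
  have sp: "space (borel_on \<Theta>) = \<Theta>" by (simp add: space_restrict_space)
  have G: "G U q \<in> sets (borel_on \<Theta>)" "asymptotically_observable {\<omega> \<in> space \<mu>. fst \<omega> \<in> G U q}"
    if "U \<in> \<U>" for U q
  proof -
    note probability_measurable[OF U[OF that], measurable]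
    have "{\<theta> \<in> space (borel_on \<Theta>). q < ?p U \<theta>} \<in> sets (borel_on \<Theta>)" by measurable
    then show "G U q \<in> sets (borel_on \<Theta>)" by (simp add: G_def sp)
    have "{\<omega> \<in> space \<mu>. fst \<omega> \<in> G U q} = {\<omega> \<in> space \<mu>. q < ?p U (fst \<omega>)}"
      by (auto simp: G_def space_\<mu>)
    then show "asymptotically_observable {\<omega> \<in> space \<mu>. fst \<omega> \<in> G U q}"
      using asymptotically_observable_superlevel[OF U[OF that]] by simp
  qed
  have \<E>: "S \<in> sets (borel_on \<Theta>) \<and> asymptotically_observable {\<omega> \<in> space \<mu>. fst \<omega> \<in> S}" if S: "S \<in> \<E>" for S
  proof -
    obtain U q where Uq: "U \<in> \<U>" "S = G U q \<or> S = \<Theta> - G U q" using S unfolding \<E>_def by auto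
    have "{\<omega> \<in> space \<mu>. fst \<omega> \<in> \<Theta> - G U q} = space \<mu> - {\<omega> \<in> space \<mu>. fst \<omega> \<in> G U q}"
      by (auto simp: space_\<mu>)
    then show ?thesis
      using Uq G[OF Uq(1), of q] sets.compl_sets[OF G(1)[OF Uq(1), of q]]
      by (auto simp: sp asymptotically_observable_Compl)
  qed
  have sep: "\<exists>S\<in>\<E>. x \<in> S \<and> y \<notin> S" if x: "x \<in> \<Theta>" and y: "y \<in> \<Theta>" and "x \<noteq> y" for x y
  proof -
    have "\<exists>U\<in>\<U>. ?p U x \<noteq> ?p U y"
    proof (rule ccontr)
      assume neg: "\<not> ?thesis"
      have id: "(\<lambda>z. z) \<in> P \<theta> \<rightarrow>\<^sub>M borel" if "\<theta> \<in> \<Theta>" for \<theta>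
        using family(2)[OF that] by (subst measurable_cong_sets[OF _ refl]) (auto intro: measurable_restrict_space1)
      have sP: "space (P \<theta>) = \<Xi>" if "\<theta> \<in> \<Theta>" for \<theta>
        using sets_eq_imp_space_eq[OF family(2)[OF that]] by (simp add: space_restrict_space)
      have e: "emeasure (distr (P \<theta>) borel (\<lambda>z. z)) V = emeasure (P \<theta>) (\<Xi> \<inter> V)"
        if "\<theta> \<in> \<Theta>" "V \<in> sets borel" for \<theta> V
        using that by (simp add: emeasure_distr[OF id] sP Int_commute vimage_def)
      \<comment> \<open>The determining class lives on the whole space, so the laws are pushed
        forward from the observation set and compared there.\<close>
      have "distr (P x) borel (\<lambda>z. z) = distr (P y) borel (\<lambda>z. z)"
      proof (rule \<U>_eqI)
        show "prob_space (distr (P x) borel (\<lambda>z. z))"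
          using family(1)[OF x] id[OF x] by (rule prob_space.prob_space_distr)
        show "\<forall>V\<in>\<U>. emeasure (distr (P x) borel (\<lambda>z. z)) V = emeasure (distr (P y) borel (\<lambda>z. z)) V"
        proof
          fix V assume V: "V \<in> \<U>"
          interpret X: prob_space "P x" by (rule family(1)[OF x])
          interpret Y: prob_space "P y" by (rule family(1)[OF y])
          have "?p V x = ?p V y" using neg V by blast
          then show "emeasure (distr (P x) borel (\<lambda>z. z)) V = emeasure (distr (P y) borel (\<lambda>z. z)) V"
            using V \<U>(2) x y by (auto simp: e X.emeasure_eq_measure Y.emeasure_eq_measure)
        qed
      qed simp_all
      then have "emeasure (P x) (\<Xi> \<inter> V) = emeasure (P y) (\<Xi> \<inter> V)" if "V \<in> sets borel" for V
        using e[OF x that] e[OF y that] by simp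
      then have "P x = P y"
        using family(2)[OF x] family(2)[OF y]
        by (intro measure_eqI) (auto simp: sets_restrict_space)
      then have "seq_law P x = seq_law P y" by (simp add: seq_law_def)
      then show False using identifiable[OF x y \<open>x \<noteq> y\<close>] by simp
    qed
    then obtain U where U: "U \<in> \<U>" "?p U x < ?p U y \<or> ?p U y < ?p U x" by (auto simp: neq_iff)
    then obtain q where q: "q \<in> \<rat>" "?p U x < q \<and> q < ?p U y \<or> ?p U y < q \<and> q < ?p U x"
      using Rats_dense_in_real by metis
    then have "x \<in> \<Theta> - G U q \<and> y \<notin> \<Theta> - G U q \<or> x \<in> G U q \<and> y \<notin> G U q"
      using x y by (auto simp: G_def)
    moreover have "G U q \<in> \<E>" "\<Theta> - G U q \<in> \<E>" using U(1) q(1) by (auto simp: \<E>_def)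
    ultimately show ?thesis by (elim disjE) (rule bexI, assumption+)+
  qed
  show ?thesis
  \<comment> \<open>Only a nonempty countable family can be enumerated. If it is empty, no two
    distinct parameters exist and any sequence separates.\<close>
  proof (cases "\<E> = {}")
    case True
    have "\<exists>j. x \<in> {} \<and> y \<notin> {}" if "x \<in> \<Theta>" "y \<in> \<Theta>" "x \<noteq> y" for x y
      using sep[OF that] True by simp
    then show ?thesis
      using asymptotically_observable_F[of "{}" 0] by (intro that[of "\<lambda>_. {}"]) simp_all
  next
    case False
    have "range (from_nat_into \<E>) = \<E>" using False \<open>countable \<E>\<close> by (rule range_from_nat_into)
    then have mem: "from_nat_into \<E> j \<in> \<E>" and ex: "S \<in> \<E> \<Longrightarrow> \<exists>j. S = from_nat_into \<E> j" for j S by blast+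
    show ?thesis
    proof (rule that[of "from_nat_into \<E>"])
      show "from_nat_into \<E> j \<in> sets (borel_on \<Theta>)"
        "asymptotically_observable {\<omega> \<in> space \<mu>. fst \<omega> \<in> from_nat_into \<E> j}" for j
        using \<E>[OF mem[of j]] by simp_all
      show "\<exists>j. x \<in> from_nat_into \<E> j \<and> y \<notin> from_nat_into \<E> j" if "x \<in> \<Theta>" "y \<in> \<Theta>" "x \<noteq> y" for x y
        using sep[OF that] ex by metis
    qed
  qed
qed

text \<open>Under the prior, A is approximated by finite unions of finite intersections of
  separating sets, and such combinations inherit asymptotic observability. This is where
  identifiability becomes a statement about finitely many observations.\<close>

lemma asymptotically_observable_parameter:
  assumes A: "A \<in> sets (borel_on \<Theta>)"
  shows "asymptotically_observable {\<omega> \<in> space \<mu>. fst \<omega> \<in> A}"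
proof (rule asymptotically_observable_limit)
  note fst_measurable[measurable]
  show "{\<omega> \<in> space \<mu>. fst \<omega> \<in> A} \<in> sets \<mu>" using A by measurable
  fix \<epsilon> :: real assume \<epsilon>: "0 < \<epsilon>"
  obtain E :: "nat \<Rightarrow> 't set" where E: "\<And>j. E j \<in> sets (borel_on \<Theta>)"
    "\<And>j. asymptotically_observable {\<omega> \<in> space \<mu>. fst \<omega> \<in> E j}"
    "\<And>x y. x \<in> \<Theta> \<Longrightarrow> y \<in> \<Theta> \<Longrightarrow> x \<noteq> y \<Longrightarrow> \<exists>j. x \<in> E j \<and> y \<notin> E j"
    using separating_sequence by blast
  have sb: "V \<in> sets (borel_on \<Theta>) \<longleftrightarrow> V \<in> sets borel \<and> V \<subseteq> \<Theta>" for V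
    using \<Theta>_borel by (subst sets_restrict_space_iff) auto
  have id: "(\<lambda>\<theta>. \<theta>) \<in> \<pi> \<rightarrow>\<^sub>M borel"
    using prior(2) by (subst measurable_cong_sets[OF _ refl]) (auto intro: measurable_restrict_space1)
  \<comment> \<open>The prior is moved to the whole space, since the approximation is stated for
    Borel measures on a Polish type.\<close>
  let ?M = "distr \<pi> borel (\<lambda>\<theta>. \<theta>)"
  interpret M: prob_space ?M by (rule prior.prob_space_distr[OF id])
  obtain \<J> where \<J>: "finite \<J>" "\<And>J. J \<in> \<J> \<Longrightarrow> finite J"
    "measure ?M (\<Theta> \<inter> sym_diff A (\<Union>J\<in>\<J>. \<Inter>j\<in>J. E j)) < \<epsilon>"
  proof (rule separating_sequence_approx[of ?M E \<Theta> A \<epsilon>])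
    show "finite_measure ?M" by unfold_locales
  qed (use A E \<Theta>_borel \<epsilon> sb in auto)
  let ?B = "\<Union>J\<in>\<J>. \<Inter>j\<in>J. E j"
  let ?D = "{\<omega> \<in> space \<mu>. \<exists>J\<in>\<J>. \<omega> \<in> {\<omega> \<in> space \<mu>. \<forall>j\<in>J. \<omega> \<in> {\<omega> \<in> space \<mu>. fst \<omega> \<in> E j}}}"
  have D: "asymptotically_observable ?D"
    using \<J>(1,2) E(2) by (intro asymptotically_observable_UN asymptotically_observable_INT) auto
  have "(\<Inter>j\<in>J. E j) \<in> sets borel" if "J \<in> \<J>" for J
    using \<J>(2)[OF that] E(1) sb by (cases "J = {}") auto
  then have B: "?B \<in> sets borel" using \<J>(1) by (intro sets.finite_UN) auto
  have S: "\<Theta> \<inter> sym_diff A ?B \<in> sets (borel_on \<Theta>)" using A B \<Theta>_borel sb by auto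
  have "sym_diff {\<omega> \<in> space \<mu>. fst \<omega> \<in> A} ?D = {\<omega> \<in> space \<mu>. fst \<omega> \<in> \<Theta> \<inter> sym_diff A ?B}"
    by (auto simp: space_\<mu>)
  then have "measure \<mu> (sym_diff {\<omega> \<in> space \<mu>. fst \<omega> \<in> A} ?D) = measure \<pi> (\<Theta> \<inter> sym_diff A ?B)"
    using emeasure_parameter[OF S] by (simp add: measure_def)
  also have "\<dots> = measure ?M (\<Theta> \<inter> sym_diff A ?B)"
    using S sb by (subst measure_distr[OF id]) (auto simp: space_\<pi> intro!: arg_cong[where f="measure \<pi>"])
  finally show "\<exists>D. asymptotically_observable D \<and> measure \<mu> (sym_diff {\<omega> \<in> space \<mu>. fst \<omega> \<in> A} D) < \<epsilon>"
    using D \<J>(3) by auto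
qed

end

section \<open>Posterior consistency\<close>

locale bayesian_posterior = bayesian_model \<Theta> \<Xi> \<pi> P \<mu>
  for \<Theta> :: "'t::polish_space set" and \<Xi> :: "'x::second_countable_topology set"
    and \<pi> :: "'t measure" and P :: "'t \<Rightarrow> 'x measure" and \<mu> :: "('t \<times> (nat \<Rightarrow> 'x)) measure" +
  fixes post :: "nat \<Rightarrow> 't \<times> (nat \<Rightarrow> 'x) \<Rightarrow> 't measure"
  assumes posterior: "\<And>n. regular_cond_distr \<mu> (obs_algebra \<Xi> \<mu> n) (borel_on \<Theta>) fst (post n)"
begin

section \<open>Averaging posteriors over observed events\<close>

lemma post_kernel: "post n \<in> F n \<rightarrow>\<^sub>M prob_algebra (borel_on \<Theta>)"
  using posterior[of n] by (simp add: regular_cond_distr_def)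

lemma
  assumes "\<omega> \<in> space \<mu>"
  shows prob_space_post: "prob_space (post n \<omega>)"
    and sets_post: "sets (post n \<omega>) = sets (borel_on \<Theta>)"
    and space_post: "space (post n \<omega>) = \<Theta>"
proof -
  have "post n \<omega> \<in> space (prob_algebra (borel_on \<Theta>))"
    using measurable_space[OF post_kernel] assms by simp
  then show "prob_space (post n \<omega>)" and s: "sets (post n \<omega>) = sets (borel_on \<Theta>)"
    by (simp_all add: space_prob_algebra)
  show "space (post n \<omega>) = \<Theta>" using sets_eq_imp_space_eq[OF s] by (simp add: space_restrict_space)
qed

lemma post_subprob_kernel: "post n \<in> F n \<rightarrow>\<^sub>M subprob_algebra (borel_on \<Theta>)"
  by (rule measurable_prob_algebraD[OF post_kernel])

lemma nn_integral_post_measurable: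
  assumes "f \<in> borel_measurable (borel_on \<Theta>)"
  shows "(\<lambda>\<omega>. \<integral>\<^sup>+\<theta>. f \<theta> \<partial>post n \<omega>) \<in> borel_measurable (F n)"
  by (rule measurable_compose[OF post_subprob_kernel nn_integral_measurable_subprob_algebra[OF assms]])

lemma emeasure_post_set:
  assumes A: "A \<in> sets (borel_on \<Theta>)" and B: "B \<in> sets (F n)"
  shows "(\<integral>\<^sup>+\<omega>\<in>B. emeasure (post n \<omega>) A \<partial>\<mu>) = emeasure \<mu> {\<omega> \<in> B. fst \<omega> \<in> A}"
proof -
  interpret S: sigma_finite_subalgebra \<mu> "F n"
    by (rule finite_measure_subalgebra_is_sigma_finite)
       (simp add: finite_measure_subalgebra_def finite_measure_subalgebra_axioms_def F_subalgebra joint.finite_measure_axioms)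
  note fst_measurable[measurable] A[measurable]
  have BM[measurable]: "B \<in> sets \<mu>" using B F_subset by blast
  have m: "(\<lambda>\<omega>. measure (post n \<omega>) A) \<in> borel_measurable (F n)"
    by (rule measurable_compose[OF post_subprob_kernel measurable_measure_subprob_algebra[OF A]])
  have m\<mu>[measurable]: "(\<lambda>\<omega>. measure (post n \<omega>) A) \<in> borel_measurable \<mu>"
    using m by (rule measurable_from_subalg[OF F_subalgebra])
  have i: "integrable \<mu> (\<lambda>\<omega>. indicator A (fst \<omega>) :: real)"
    by (rule joint.integrable_const_bound[of _ 1]) (auto simp: indicator_def)
  have le1: "measure (post n \<omega>) A \<le> 1" if "\<omega> \<in> space \<mu>" for \<omega>
    using prob_space.prob_le_1[OF prob_space_post[OF that]] .
  have AE: "AE \<omega> in \<mu>. measure (post n \<omega>) A = real_cond_exp \<mu> (F n) (\<lambda>\<omega>. indicator A (fst \<omega>)) \<omega>"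
    using posterior[of n] A by (simp add: regular_cond_distr_def)
  have "(\<integral>\<^sup>+\<omega>\<in>B. emeasure (post n \<omega>) A \<partial>\<mu>) = (\<integral>\<^sup>+\<omega>. ennreal (measure (post n \<omega>) A * indicator B \<omega>) \<partial>\<mu>)"
    using prob_space_post
    by (intro nn_integral_cong)
       (auto simp: finite_measure.emeasure_eq_measure prob_space.finite_measure split: split_indicator)
  also have "\<dots> = ennreal (\<integral>\<omega>. measure (post n \<omega>) A * indicator B \<omega> \<partial>\<mu>)"
    using le1 by (intro nn_integral_eq_integral joint.integrable_const_bound[of _ 1])
      (auto split: split_indicator)
  also have "(\<integral>\<omega>. measure (post n \<omega>) A * indicator B \<omega> \<partial>\<mu>)
      = (\<integral>\<omega>\<in>B. real_cond_exp \<mu> (F n) (\<lambda>\<omega>. indicator A (fst \<omega>)) \<omega> \<partial>\<mu>)"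
    unfolding set_lebesgue_integral_def
    using AE by (intro integral_cong_AE) auto
  also have "\<dots> = (\<integral>\<omega>\<in>B. indicator A (fst \<omega>) \<partial>\<mu>)"
    by (rule S.real_cond_exp_intA[OF i B, symmetric])
  also have "\<dots> = (\<integral>\<omega>. indicator {\<omega> \<in> B. fst \<omega> \<in> A} \<omega> \<partial>\<mu>)"
    unfolding set_lebesgue_integral_def by (intro Bochner_Integration.integral_cong) (auto split: split_indicator)
  also have "\<dots> = measure \<mu> {\<omega> \<in> B. fst \<omega> \<in> A}"
    using sets.sets_into_space[OF BM] by (simp add: Int_absorb2 subset_iff)
  finally show ?thesis by (simp add: joint.emeasure_eq_measure)
qed

text \<open>Both sides integrate \<open>f\<close> against a measure on the parameter set: the
  posteriors mixed over B, and the parameter law restricted to B. By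
  \<open>emeasure_post_set\<close> the two measures coincide, so no induction over \<open>f\<close>
  is required.\<close>

lemma nn_integral_post_set:
  assumes f: "f \<in> borel_measurable (borel_on \<Theta>)" and B: "B \<in> sets (F n)"
  shows "(\<integral>\<^sup>+\<omega>\<in>B. (\<integral>\<^sup>+\<theta>. f \<theta> \<partial>post n \<omega>) \<partial>\<mu>) = (\<integral>\<^sup>+\<omega>\<in>B. f (fst \<omega>) \<partial>\<mu>)"
proof -
  let ?D = "density \<mu> (indicator B)"
  have BM[measurable]: "B \<in> sets \<mu>" using B F_subset by blast
  have pm: "post n \<in> \<mu> \<rightarrow>\<^sub>M subprob_algebra (borel_on \<Theta>)"
    using post_subprob_kernel by (rule measurable_from_subalg[OF F_subalgebra])
  then have pD: "post n \<in> ?D \<rightarrow>\<^sub>M subprob_algebra (borel_on \<Theta>)" by simp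
  have ne: "space ?D \<noteq> {}" using joint.not_empty by simp
  have fD: "fst \<in> ?D \<rightarrow>\<^sub>M borel_on \<Theta>" using fst_measurable by simp
  have eq: "?D \<bind> post n = distr ?D (borel_on \<Theta>) fst"
  proof (rule measure_eqI)
    show s: "sets (?D \<bind> post n) = sets (distr ?D (borel_on \<Theta>) fst)"
      using sets_bind_measurable[OF pD ne] by simp
    fix A assume "A \<in> sets (?D \<bind> post n)"
    then have A: "A \<in> sets (borel_on \<Theta>)" using s by simp
    have "emeasure (?D \<bind> post n) A = (\<integral>\<^sup>+\<omega>. emeasure (post n \<omega>) A \<partial>?D)"
      by (rule emeasure_bind[OF ne pD A])
    also have "\<dots> = (\<integral>\<^sup>+\<omega>\<in>B. emeasure (post n \<omega>) A \<partial>\<mu>)"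
      using measurable_emeasure_kernel[OF pm A]
      by (subst nn_integral_density) (auto simp: mult.commute)
    also have "\<dots> = emeasure \<mu> {\<omega> \<in> B. fst \<omega> \<in> A}" by (rule emeasure_post_set[OF A B])
    also have "{\<omega> \<in> B. fst \<omega> \<in> A} = B \<inter> (fst -` A \<inter> space \<mu>)"
      using sets.sets_into_space[OF BM] by auto
    also have "emeasure \<mu> \<dots> = emeasure ?D (fst -` A \<inter> space \<mu>)"
      using measurable_sets[OF fst_measurable A]
      by (subst emeasure_density) (auto simp: indicator_inter_arith[symmetric])
    also have "\<dots> = emeasure (distr ?D (borel_on \<Theta>) fst) A"
      using A fD by (simp add: emeasure_distr)
    finally show "emeasure (?D \<bind> post n) A = emeasure (distr ?D (borel_on \<Theta>) fst) A" .
  qed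
  note [measurable] = nn_integral_post_measurable[OF f, THEN measurable_from_subalg[OF F_subalgebra]]
    measurable_compose[OF fst_measurable f]
  have "(\<integral>\<^sup>+\<omega>\<in>B. (\<integral>\<^sup>+\<theta>. f \<theta> \<partial>post n \<omega>) \<partial>\<mu>) = (\<integral>\<^sup>+\<theta>. f \<theta> \<partial>(?D \<bind> post n))"
    by (subst nn_integral_bind[OF f pD], subst nn_integral_density) (auto simp: mult.commute)
  also have "\<dots> = (\<integral>\<^sup>+\<omega>. f (fst \<omega>) \<partial>?D)"
    unfolding eq by (rule nn_integral_distr[OF fD]) (use f in simp)
  also have "\<dots> = (\<integral>\<^sup>+\<omega>\<in>B. f (fst \<omega>) \<partial>\<mu>)"
    by (subst nn_integral_density) (auto simp: mult.commute)
  finally show ?thesis .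
qed

text \<open>Doob's maximal inequality for the martingale of posterior expectations of \<open>f\<close>, by
  decomposition according to the first time at which the level \<open>c\<close> is exceeded.\<close>

lemma posterior_maximal_inequality:
  assumes f: "f \<in> borel_measurable (borel_on \<Theta>)" and B: "B \<in> sets (F m)"
  shows "c * emeasure \<mu> {\<omega> \<in> B. \<exists>n\<ge>m. c < (\<integral>\<^sup>+\<theta>. f \<theta> \<partial>post n \<omega>)} \<le> (\<integral>\<^sup>+\<omega>\<in>B. f (fst \<omega>) \<partial>\<mu>)"
proof -
  define Z where "Z n \<omega> = (\<integral>\<^sup>+\<theta>. f \<theta> \<partial>post n \<omega>)" for n \<omega>
  have Z[measurable]: "Z n \<in> borel_measurable (F n)" for n
    unfolding Z_def by (rule nn_integral_post_measurable[OF f])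
  have fm[measurable]: "(\<lambda>\<omega>. f (fst \<omega>)) \<in> borel_measurable \<mu>" by (rule measurable_compose[OF fst_measurable f])
  have BM[measurable]: "B \<in> sets \<mu>" using B F_subset by blast
  define T where "T i = {\<omega> \<in> B. c < Z (m + i) \<omega> \<and> (\<forall>k<i. Z (m + k) \<omega> \<le> c)}" for i
  have TF: "T i \<in> sets (F (m + i))" for i
  proof -
    have [measurable]: "Z (m + k) \<in> borel_measurable (F (m + i))" if "k \<le> i" for k
      by (rule measurable_from_subalg[OF _ Z]) (use that F_mono in \<open>simp add: subalgebra_def\<close>)
    have B': "B \<in> sets (F (m + i))" using B F_mono[of m "m + i"] by auto
    have "B \<inter> {\<omega> \<in> space (F (m + i)). c < Z (m + i) \<omega> \<and> (\<forall>k\<in>{..<i}. Z (m + k) \<omega> \<le> c)} \<in> sets (F (m + i))"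
      by (intro sets.Int B' sets.sets_Collect sets.sets_Collect_finite_All borel_measurable_less borel_measurable_le) (auto)
    also have "B \<inter> {\<omega> \<in> space (F (m + i)). c < Z (m + i) \<omega> \<and> (\<forall>k\<in>{..<i}. Z (m + k) \<omega> \<le> c)} = T i"
      using sets.sets_into_space[OF B] by (auto simp: T_def)
    finally show ?thesis .
  qed
  then have TM[measurable]: "T i \<in> sets \<mu>" for i using F_subset by blast
  have disj: "disjoint_family T"
    unfolding disjoint_family_on_def T_def by (auto simp: disjoint_iff) (metis linorder_neqE_nat not_le)
  have UN: "(\<Union>i. T i) = {\<omega> \<in> B. \<exists>n\<ge>m. c < Z n \<omega>}"
  proof
    show "(\<Union>i. T i) \<subseteq> {\<omega> \<in> B. \<exists>n\<ge>m. c < Z n \<omega>}" unfolding T_def using le_add1 by blast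
    show "{\<omega> \<in> B. \<exists>n\<ge>m. c < Z n \<omega>} \<subseteq> (\<Union>i. T i)"
    proof
      fix \<omega> assume "\<omega> \<in> {\<omega> \<in> B. \<exists>n\<ge>m. c < Z n \<omega>}"
      then have "\<omega> \<in> B" "\<exists>i. c < Z (m + i) \<omega>" by (auto simp: le_iff_add)
      then have "c < Z (m + (LEAST i. c < Z (m + i) \<omega>)) \<omega>"
        "\<forall>k<(LEAST i. c < Z (m + i) \<omega>). Z (m + k) \<omega> \<le> c"
        by (auto intro: LeastI_ex dest: not_less_Least simp: not_less[symmetric])
      with \<open>\<omega> \<in> B\<close> show "\<omega> \<in> (\<Union>i. T i)" unfolding T_def by blast
    qed
  qed
  let ?D = "density \<mu> (\<lambda>\<omega>. f (fst \<omega>))"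
  have ED: "emeasure ?D S = (\<integral>\<^sup>+\<omega>\<in>S. f (fst \<omega>) \<partial>\<mu>)" if "S \<in> sets \<mu>" for S
    using that by (simp add: emeasure_density)
  \<comment> \<open>On \<open>T i\<close> the level is exceeded at time m + i, and
    \<open>T i\<close> is already observed at that time; averaging over it turns the posterior mean
    back into \<open>f\<close>.\<close>
  have le: "c * emeasure \<mu> (T i) \<le> emeasure ?D (T i)" for i
  proof -
    have "c * emeasure \<mu> (T i) = (\<integral>\<^sup>+\<omega>\<in>T i. c \<partial>\<mu>)" by (simp add: nn_integral_cmult_indicator)
    also have "\<dots> \<le> (\<integral>\<^sup>+\<omega>\<in>T i. Z (m + i) \<omega> \<partial>\<mu>)"
      by (intro nn_integral_mono) (auto simp: T_def split: split_indicator)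
    also have "\<dots> = emeasure ?D (T i)"
      unfolding Z_def using nn_integral_post_set[OF f TF] ED by simp
    finally show ?thesis .
  qed
  have "c * emeasure \<mu> (\<Union>i. T i) = (\<Sum>i. c * emeasure \<mu> (T i))"
    using disj by (subst suminf_emeasure[symmetric]) auto
  also have "\<dots> \<le> (\<Sum>i. emeasure ?D (T i))" by (intro suminf_le le) auto
  also have "\<dots> = emeasure ?D (\<Union>i. T i)" using disj by (intro suminf_emeasure) auto
  also have "\<dots> \<le> emeasure ?D B" unfolding UN by (intro emeasure_mono) auto
  finally show ?thesis unfolding UN by (simp add: ED Z_def)
qed

section \<open>Concentration at the true parameter\<close>

lemma emeasure_post_measurable:
  assumes "A \<in> sets (borel_on \<Theta>)"
  shows "(\<lambda>\<omega>. emeasure (post n \<omega>) A) \<in> borel_measurable \<mu>"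
  using measurable_emeasure_kernel[OF post_subprob_kernel assms]
  by (rule measurable_from_subalg[OF F_subalgebra])

text \<open>Let B, known at time m, approximate the event of A up to \<delta>. The indicator of the
  complement of A integrates to at most \<delta> over B, so by the maximal inequality its posterior
  exceeds c on B after time m with probability at most \<delta> / c. Outside B, the event of A has
  probability at most \<delta>.\<close>

lemma AE_eventually_post_le:
  assumes A: "A \<in> sets (borel_on \<Theta>)" and c: "0 < c"
  shows "AE \<omega> in \<mu>. fst \<omega> \<in> A \<longrightarrow> (\<exists>m. \<forall>n\<ge>m. emeasure (post n \<omega>) (\<Theta> - A) \<le> ennreal c)"
proof -
  note [measurable] = fst_measurable emeasure_post_measurable A
  let ?e = "\<lambda>n \<omega>. emeasure (post n \<omega>) (\<Theta> - A)"
  let ?A = "{\<omega> \<in> space \<mu>. fst \<omega> \<in> A}"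
  have Ac: "\<Theta> - A \<in> sets (borel_on \<Theta>)" 
    using sets.compl_sets[OF A] by (simp add: space_restrict_space)
  note [measurable] = emeasure_post_measurable[OF Ac]
  define N where "N = {\<omega> \<in> space \<mu>. fst \<omega> \<in> A \<and> (\<forall>m. \<exists>n\<in>{m..}. ennreal c < ?e n \<omega>)}"
  have N[measurable]: "N \<in> sets \<mu>" unfolding N_def by measurable
  have "measure \<mu> N \<le> 0 + \<epsilon>" if "0 < \<epsilon>" for \<epsilon>
  proof -
    \<comment> \<open>The solution of \<delta> + \<delta> / c = \<epsilon>: the first term pays for
      the approximation, the second for exceeding c.\<close>
    define \<delta> where "\<delta> = \<epsilon> / (1 + 1 / c)"
    have \<delta>: "0 < \<delta>" using that c by (simp add: \<delta>_def add_pos_pos)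
    obtain m B where B: "B \<in> sets (F m)" "measure \<mu> (sym_diff ?A B) < \<delta>"
      using asymptotically_observable_parameter[OF A] \<delta> unfolding asymptotically_observable_def by blast
    have [measurable]: "B \<in> sets \<mu>" using B(1) F_subset by blast
    let ?X = "{\<omega> \<in> B. \<exists>n\<in>{m..}. ennreal c < ?e n \<omega>}"
    have Xeq: "?X = B \<inter> {\<omega> \<in> space \<mu>. \<exists>n\<in>{m..}. ennreal c < ?e n \<omega>}"
      using sets.sets_into_space[OF B(1)] by auto
    have [measurable]: "?X \<in> sets \<mu>" unfolding Xeq by measurable
    have "(\<lambda>\<theta>. indicator (\<Theta> - A) \<theta> :: ennreal) \<in> borel_measurable (borel_on \<Theta>)"
      using Ac by measurable
    from posterior_maximal_inequality[OF this B(1), of "ennreal c"]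
    have "ennreal c * emeasure \<mu> {\<omega> \<in> B. \<exists>n\<ge>m. ennreal c < (\<integral>\<^sup>+\<theta>. indicator (\<Theta> - A) \<theta> \<partial>post n \<omega>)}
        \<le> (\<integral>\<^sup>+\<omega>\<in>B. indicator (\<Theta> - A) (fst \<omega>) \<partial>\<mu>)" .
    also have "{\<omega> \<in> B. \<exists>n\<ge>m. ennreal c < (\<integral>\<^sup>+\<theta>. indicator (\<Theta> - A) \<theta> \<partial>post n \<omega>)} = ?X"
    proof (intro Collect_cong conj_cong refl)
      fix \<omega> assume "\<omega> \<in> B"
      then have "\<omega> \<in> space \<mu>" using sets.sets_into_space[OF B(1)] by auto
      then have "(\<integral>\<^sup>+\<theta>. indicator (\<Theta> - A) \<theta> \<partial>post n \<omega>) = ?e n \<omega>" for n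
        using Ac by (intro nn_integral_indicator) (simp add: sets_post)
      then show "(\<exists>n\<ge>m. ennreal c < (\<integral>\<^sup>+\<theta>. indicator (\<Theta> - A) \<theta> \<partial>post n \<omega>)) = (\<exists>n\<in>{m..}. ennreal c < ?e n \<omega>)"
        by auto
    qed
    also have "(\<integral>\<^sup>+\<omega>\<in>B. indicator (\<Theta> - A) (fst \<omega>) \<partial>\<mu>) = (\<integral>\<^sup>+\<omega>. indicator (B - ?A) \<omega> \<partial>\<mu>)"
      using sets.sets_into_space[OF B(1)]
      by (intro nn_integral_cong) (auto simp: space_\<mu> split: split_indicator)
    also have "\<dots> = emeasure \<mu> (B - ?A)" by (rule nn_integral_indicator) measurable
    finally have "c * measure \<mu> ?X \<le> measure \<mu> (B - ?A)"
      using c by (simp add: joint.emeasure_eq_measure ennreal_mult[symmetric])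
    also have "\<dots> \<le> measure \<mu> (sym_diff ?A B)" by (rule joint.finite_measure_mono) auto
    finally have X: "measure \<mu> ?X \<le> \<delta> / c" using B(2) c by (simp add: field_simps)
    have "measure \<mu> N \<le> measure \<mu> (sym_diff ?A B \<union> ?X)"
      by (rule joint.finite_measure_mono) (auto simp: N_def)
    also have "\<dots> \<le> measure \<mu> (sym_diff ?A B) + measure \<mu> ?X" by (rule measure_Un_le) auto
    also have "\<dots> \<le> \<delta> + \<delta> / c" using B(2) X by simp
    also have "\<dots> = \<delta> * (1 + 1 / c)" by (simp add: distrib_left)
    also have "\<dots> = \<epsilon>" using c add_pos_pos[of 1 "1 / c"] by (simp add: \<delta>_def)
    finally show ?thesis by simp
  qed
  then have "measure \<mu> N \<le> 0" by (rule field_le_epsilon)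
  then have "emeasure \<mu> N = 0" by (simp add: joint.emeasure_eq_measure ennreal_neg)
  then show ?thesis
    by (intro AE_I[OF _ _ N]) (auto simp: N_def not_le)
qed

lemma AE_post_compl_tendsto_0:
  assumes A: "A \<in> sets (borel_on \<Theta>)"
  shows "AE \<omega> in \<mu>. fst \<omega> \<in> A \<longrightarrow> (\<lambda>n. measure (post n \<omega>) (\<Theta> - A)) \<longlonglongrightarrow> 0"
proof -
  have "AE \<omega> in \<mu>. \<forall>k. fst \<omega> \<in> A \<longrightarrow>
      (\<exists>m. \<forall>n\<ge>m. emeasure (post n \<omega>) (\<Theta> - A) \<le> ennreal (inverse (real (Suc k))))"
    unfolding AE_all_countable by (intro allI AE_eventually_post_le A) simp
  with AE_space show ?thesis
  proof eventually_elim
    case (elim \<omega>)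
    show ?case
    proof (intro impI tendstoI)
      fix e :: real assume A: "fst \<omega> \<in> A" and "0 < e"
      then obtain k where k: "inverse (real (Suc k)) < e" using reals_Archimedean by blast
      obtain m where m: "\<And>n. n \<ge> m \<Longrightarrow> emeasure (post n \<omega>) (\<Theta> - A) \<le> ennreal (inverse (real (Suc k)))"
        using elim A by blast
      have "dist (measure (post n \<omega>) (\<Theta> - A)) 0 < e" if "n \<ge> m" for n
      proof -
        interpret prob_space "post n \<omega>" by (rule prob_space_post[OF elim(1)])
        have "measure (post n \<omega>) (\<Theta> - A) \<le> inverse (real (Suc k))"
          using m[OF that] by (simp add: emeasure_eq_measure del: of_nat_Suc)
        then show ?thesis using k by simp
      qed
      then show "\<forall>\<^sub>F n in sequentially. dist (measure (post n \<omega>) (\<Theta> - A)) 0 < e"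
        using eventually_sequentially by blast
    qed
  qed
qed

text \<open>Passing through a countable base collects the exceptional sets into one null set that
  serves all neighbourhoods.\<close>

theorem posterior_consistency:
  "AE \<omega> in \<mu>. \<forall>V. open V \<longrightarrow> fst \<omega> \<in> V \<longrightarrow> (\<lambda>n. measure (post n \<omega>) (\<Theta> - V)) \<longlonglongrightarrow> 0"
proof -
  obtain B :: "'t set set" where B: "countable B" "topological_basis B"
    using ex_countable_basis by blast
  have "AE \<omega> in \<mu>. \<forall>V\<in>B. fst \<omega> \<in> \<Theta> \<inter> V \<longrightarrow> (\<lambda>n. measure (post n \<omega>) (\<Theta> - \<Theta> \<inter> V)) \<longlonglongrightarrow> 0"
    unfolding AE_ball_countable[OF B(1)] using topological_basis_open[OF B(2)]
    by (intro ballI AE_post_compl_tendsto_0) (auto simp: sets_restrict_space)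
  with AE_space show ?thesis
  proof eventually_elim
    case (elim \<omega>)
    show ?case
    proof (intro allI impI)
      fix V :: "'t set" assume V: "open V" "fst \<omega> \<in> V"
      obtain W where W: "W \<in> B" "fst \<omega> \<in> W" "W \<subseteq> V" using topological_basisE[OF B(2) V] .
      have lim: "(\<lambda>n. measure (post n \<omega>) (\<Theta> - \<Theta> \<inter> W)) \<longlonglongrightarrow> 0"
        using elim W(1,2) by (auto simp: space_\<mu>)
      show "(\<lambda>n. measure (post n \<omega>) (\<Theta> - V)) \<longlonglongrightarrow> 0"
      proof (rule tendsto_sandwich[OF _ _ tendsto_const lim])
        show "\<forall>\<^sub>F n in sequentially. measure (post n \<omega>) (\<Theta> - V) \<le> measure (post n \<omega>) (\<Theta> - \<Theta> \<inter> W)"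
        proof (intro always_eventually allI)
          fix n
          interpret prob_space "post n \<omega>" by (rule prob_space_post[OF elim(1)])
          have "\<Theta> - \<Theta> \<inter> W \<in> sets (post n \<omega>)"
            using topological_basis_open[OF B(2) W(1)] \<Theta>_borel unfolding sets_post[OF elim(1)]
            by (subst sets_restrict_space_iff) auto
          then show "measure (post n \<omega>) (\<Theta> - V) \<le> measure (post n \<omega>) (\<Theta> - \<Theta> \<inter> W)"
            using W(3) by (intro finite_measure_mono) auto
        qed
      qed simp
    qed
  qed
qed

text \<open>The maximal inequality from time 0 on the whole space bounds the probability that the
  posterior means ever exceed k by the prior mean divided by k, which tends to 0.\<close>

lemma AE_post_nn_integral_bounded:
  assumes f: "f \<in> borel_measurable (borel_on \<Theta>)" and fin: "(\<integral>\<^sup>+\<theta>. f \<theta> \<partial>\<pi>) < \<infinity>"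
  shows "AE \<omega> in \<mu>. \<exists>c::real. 0 \<le> c \<and> (\<forall>n. (\<integral>\<^sup>+\<theta>. f \<theta> \<partial>post n \<omega>) \<le> ennreal c)"
proof -
  let ?Z = "\<lambda>n \<omega>. \<integral>\<^sup>+\<theta>. f \<theta> \<partial>post n \<omega>"
  note [measurable] = nn_integral_post_measurable[OF f, THEN measurable_from_subalg[OF F_subalgebra]]
  have dist: "distr \<mu> (borel_on \<Theta>) fst = \<pi>"
  proof (rule measure_eqI)
    show "emeasure (distr \<mu> (borel_on \<Theta>) fst) A = emeasure \<pi> A" if "A \<in> sets (distr \<mu> (borel_on \<Theta>) fst)" for A
      using that emeasure_parameter[of A]
      by (auto simp: emeasure_distr[OF fst_measurable] vimage_def Int_def conj_commute)
  qed (simp add: prior(2))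
  have I: "(\<integral>\<^sup>+\<omega>. f (fst \<omega>) \<partial>\<mu>) = (\<integral>\<^sup>+\<theta>. f \<theta> \<partial>\<pi>)"
    using nn_integral_distr[OF fst_measurable, of f] f by (simp add: dist measurable_cong_sets[OF prior(2) refl])
  obtain r where r: "(\<integral>\<^sup>+\<theta>. f \<theta> \<partial>\<pi>) = ennreal r" "0 \<le> r" using fin by (cases "\<integral>\<^sup>+\<theta>. f \<theta> \<partial>\<pi>") auto
  define N where "N = {\<omega> \<in> space \<mu>. \<forall>k::nat. \<exists>n. ennreal (real k) < ?Z n \<omega>}"
  have N: "N \<in> sets \<mu>" unfolding N_def by measurable
  have bound: "real k * measure \<mu> N \<le> r" for k
  proof -
    have "ennreal (real k) * emeasure \<mu> N \<le> ennreal (real k) * emeasure \<mu> {\<omega> \<in> space \<mu>. \<exists>n\<ge>0. ennreal (real k) < ?Z n \<omega>}"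
      by (intro mult_left_mono emeasure_mono) (auto simp: N_def)
    also have "\<dots> \<le> (\<integral>\<^sup>+\<omega>\<in>space \<mu>. f (fst \<omega>) \<partial>\<mu>)"
      using sets.top[of "F 0"] by (intro posterior_maximal_inequality[OF f]) simp
    also have "\<dots> = ennreal r" unfolding r(1)[symmetric] I[symmetric] by (intro nn_integral_cong) auto
    finally show ?thesis using r(2) by (simp add: joint.emeasure_eq_measure ennreal_mult[symmetric])
  qed
  have "measure \<mu> N = 0"
  proof (rule ccontr)
    assume "measure \<mu> N \<noteq> 0"
    then have "0 < measure \<mu> N" by (simp add: zero_less_measure_iff)
    then obtain k :: nat where "r < real k * measure \<mu> N" using ex_less_of_nat_mult by blast
    with bound[of k] show False by simp
  qed
  then have "emeasure \<mu> N = 0" by (simp add: joint.emeasure_eq_measure)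
  then have "AE \<omega> in \<mu>. \<exists>k::nat. \<forall>n. ?Z n \<omega> \<le> ennreal (real k)"
    by (intro AE_I[OF _ _ N]) (auto simp: N_def not_le)
  then show ?thesis by eventually_elim (metis of_nat_0_le_iff)
qed

text \<open>The average of the posterior over \<mu> is the prior, so a null set of the prior is
  almost surely null for the posterior; there are only countably many n.\<close>

lemma AE_post_AE:
  assumes "AE \<theta> in \<pi>. Q \<theta>"
  shows "AE \<omega> in \<mu>. \<forall>n. AE \<theta> in post n \<omega>. Q \<theta>"
  unfolding AE_all_countable
proof
  fix n
  obtain N where N: "{\<theta> \<in> space \<pi>. \<not> Q \<theta>} \<subseteq> N" "emeasure \<pi> N = 0" "N \<in> sets \<pi>"
    using assms by (rule AE_E)
  have N': "N \<in> sets (borel_on \<Theta>)" using N(3) prior(2) by simp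
  have "(\<integral>\<^sup>+\<omega>. emeasure (post n \<omega>) N \<partial>\<mu>) = (\<integral>\<^sup>+\<omega>\<in>space \<mu>. emeasure (post n \<omega>) N \<partial>\<mu>)"
    by (intro nn_integral_cong) auto
  also have "\<dots> = 0"
    using emeasure_post_set[OF N', of "space \<mu>" n] sets.top[of "F n"] emeasure_parameter[OF N'] N(2) by simp
  finally have "AE \<omega> in \<mu>. emeasure (post n \<omega>) N = 0"
    using emeasure_post_measurable[OF N'] by (simp add: nn_integral_0_iff_AE)
  with AE_space show "AE \<omega> in \<mu>. AE \<theta> in post n \<omega>. Q \<theta>"
  proof eventually_elim
    case (elim \<omega>)
    show ?case
      using elim N(1) N' by (intro AE_I[of _ _ N]) (auto simp: space_post sets_post space_\<pi>)
  qed
qed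

end

section \<open>Risk under concentrating measures\<close>

text \<open>The deterministic situation for one fixed outcome: \<open>M\<close> is its sequence of
  posteriors and \<open>t\<close> its true parameter.\<close>

locale concentrating_measures =
  fixes \<Theta> :: "'t::metric_space set" and M :: "nat \<Rightarrow> 't measure" and t :: 't
    and X :: "'d::euclidean_space set" and N :: "'d \<Rightarrow> real" and H :: "'d \<Rightarrow> 't \<Rightarrow> real"
  assumes prob: "\<And>n. prob_space (M n)" and sets_M: "\<And>n. sets (M n) = sets (borel_on \<Theta>)"
    and compact_\<Theta>: "compact \<Theta>" and t: "t \<in> \<Theta>"
    and conc: "\<And>V. open V \<Longrightarrow> t \<in> V \<Longrightarrow> (\<lambda>n. measure (M n) (\<Theta> - V)) \<longlonglongrightarrow> 0"
    and compact_X: "compact X" and X_ne: "X \<noteq> {}" and norm: "is_norm N"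
    and cont_H: "\<And>x. x \<in> X \<Longrightarrow> continuous_on \<Theta> (H x)"
begin

sublocale prob_space "M n" for n by (rule prob)

lemma space_M: "space (M n) = \<Theta>"
  using sets_eq_imp_space_eq[OF sets_M] by (simp add: space_restrict_space)

lemma continuous_measurable: "continuous_on \<Theta> f \<Longrightarrow> f \<in> borel_measurable (M n)"
  for f :: "'t \<Rightarrow> real"
  using borel_measurable_continuous_on_restrict by (simp add: measurable_cong_sets[OF sets_M refl])

lemma continuous_bounded:
  fixes f :: "'t \<Rightarrow> real"
  assumes "continuous_on \<Theta> f"
  obtains B where "0 < B" "\<And>\<theta>. \<theta> \<in> \<Theta> \<Longrightarrow> \<bar>f \<theta>\<bar> \<le> B"
  using compact_imp_bounded[OF compact_continuous_image[OF assms compact_\<Theta>]]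
  by (auto simp: bounded_pos)

lemma continuous_integrable:
  fixes f :: "'t \<Rightarrow> real"
  assumes "continuous_on \<Theta> f"
  shows "integrable (M n) f"
proof -
  obtain B where B: "\<And>\<theta>. \<theta> \<in> \<Theta> \<Longrightarrow> \<bar>f \<theta>\<bar> \<le> B" using continuous_bounded[OF assms] by blast
  show ?thesis
    by (rule integrable_const_bound[where B=B]) (use B continuous_measurable[OF assms] in \<open>auto simp: space_M\<close>)
qed

abbreviation L1_dist :: "nat \<Rightarrow> ('t \<Rightarrow> real) \<Rightarrow> ('t \<Rightarrow> real) \<Rightarrow> real" where
  "L1_dist n f g \<equiv> (\<integral>\<theta>. \<bar>f \<theta> - g \<theta>\<bar> \<partial>M n)"

lemma integrable_abs_diff:
  "continuous_on \<Theta> f \<Longrightarrow> continuous_on \<Theta> g \<Longrightarrow> integrable (M n) (\<lambda>\<theta>. \<bar>f \<theta> - g \<theta> :: real\<bar>)"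
  by (intro continuous_integrable continuous_intros)

text \<open>Off \<open>V\<close> the integrand is at most 2B. The lemma serves twice: with
  \<open>V\<close> and \<open>B\<close> adapted to a single function, and with one choice for all
  \<open>H x\<close>.\<close>

lemma L1_dist_const_le:
  fixes f :: "'t \<Rightarrow> real"
  assumes f: "continuous_on \<Theta> f" and V: "open V"
    and near: "\<And>\<theta>. \<theta> \<in> \<Theta> \<Longrightarrow> \<theta> \<in> V \<Longrightarrow> \<bar>f \<theta> - f t\<bar> \<le> \<epsilon>"
    and B: "\<And>\<theta>. \<theta> \<in> \<Theta> \<Longrightarrow> \<bar>f \<theta>\<bar> \<le> B" and \<epsilon>: "0 \<le> \<epsilon>"
  shows "L1_dist n f (\<lambda>_. f t) \<le> \<epsilon> + 2 * B * measure (M n) (\<Theta> - V)"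
proof -
  have [measurable]: "\<Theta> - V \<in> sets (M n)"
  proof -
    have "space (borel_on \<Theta>) - \<Theta> \<inter> V \<in> sets (borel_on \<Theta>)"
      using V by (intro sets.compl_sets) (auto simp: sets_restrict_space)
    moreover have "\<Theta> - \<Theta> \<inter> V = \<Theta> - V" by blast
    ultimately show ?thesis by (simp add: sets_M space_restrict_space)
  qed
  have "L1_dist n f (\<lambda>_. f t) \<le> (\<integral>\<theta>. \<epsilon> + 2 * B * indicator (\<Theta> - V) \<theta> \<partial>M n)"
  proof (intro integral_mono)
    show "integrable (M n) (\<lambda>\<theta>. \<bar>f \<theta> - f t\<bar>)" by (intro integrable_abs_diff f continuous_on_const)
    show "\<bar>f \<theta> - f t\<bar> \<le> \<epsilon> + 2 * B * indicator (\<Theta> - V) \<theta>" if "\<theta> \<in> space (M n)" for \<theta>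
      using that near[of \<theta>] B[of \<theta>] B[OF t] \<epsilon> by (auto simp: space_M indicator_def)
  qed (auto simp: emeasure_eq_measure)
  also have "\<dots> = \<epsilon> + 2 * B * measure (M n) (\<Theta> - V)"
    using prob_space[of n]
    by (subst Bochner_Integration.integral_add) (auto simp: emeasure_eq_measure Int_absorb2 space_M)
  finally show ?thesis .
qed

lemma L1_dist_const_tendsto_0:
  assumes f: "continuous_on \<Theta> f"
  shows "(\<lambda>n. L1_dist n f (\<lambda>_. f t)) \<longlonglongrightarrow> 0"
proof (rule tendstoI)
  fix e :: real assume e: "0 < e"
  obtain B where B: "0 < B" "\<And>\<theta>. \<theta> \<in> \<Theta> \<Longrightarrow> \<bar>f \<theta>\<bar> \<le> B" using continuous_bounded[OF f] by blast
  obtain d where d: "0 < d" "\<And>\<theta>. \<theta> \<in> \<Theta> \<Longrightarrow> dist \<theta> t < d \<Longrightarrow> dist (f \<theta>) (f t) < e / 2"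
    using f t e unfolding continuous_on_iff by (metis half_gt_zero)
  have "(\<lambda>n. 2 * B * measure (M n) (\<Theta> - ball t d)) \<longlonglongrightarrow> 2 * B * 0"
    using d(1) by (intro tendsto_intros conc) auto
  then have "\<forall>\<^sub>F n in sequentially. 2 * B * measure (M n) (\<Theta> - ball t d) < e / 2"
    using e by (intro order_tendstoD(2)) auto
  then show "\<forall>\<^sub>F n in sequentially. dist (L1_dist n f (\<lambda>_. f t)) 0 < e"
  proof eventually_elim
    case (elim n)
    have "L1_dist n f (\<lambda>_. f t) \<le> e / 2 + 2 * B * measure (M n) (\<Theta> - ball t d)"
      using d(2) B(2) e by (intro L1_dist_const_le f) (auto simp: dist_real_def dist_commute less_imp_le)
    then show ?case using elim by (simp add: abs_of_nonneg)
  qed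
qed

section \<open>Convergence of minimizers for each risk functional\<close>

definition uniformly_L1_consistent :: bool where
  "uniformly_L1_consistent \<longleftrightarrow>
    (\<forall>e>0. \<forall>\<^sub>F n in sequentially. \<forall>x\<in>X. L1_dist n (H x) (\<lambda>_. H x t) < e)"

text \<open>Uniform convergence alone does not suffice: without continuity in \<open>x\<close> the approximating
  objectives need not attain their minimum, and the deviation of the empty set is \<open>-\<infinity>\<close>.\<close>

definition L1_continuous :: bool where
  "L1_continuous \<longleftrightarrow> (\<forall>n. \<forall>x\<in>X. ((\<lambda>y. L1_dist n (H y) (H x)) \<longlongrightarrow> 0) (at x within X))"

text \<open>The common argument for mean, CVaR and mean-variance. The assumption \<open>lip\<close>
  yields continuity of the approximating objectives, \<open>const\<close> their uniform convergence;
  the latter is the Lipschitz bound against a constant function, which these functionals map to its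
  value.\<close>

lemma deviation_lipschitz_risk:
  assumes unif: uniformly_L1_consistent and L1: L1_continuous and H_t: "continuous_on X (\<lambda>x. H x t)"
    and L: "0 < L"
    and lip: "\<And>n x y. x \<in> X \<Longrightarrow> y \<in> X \<Longrightarrow> \<bar>\<rho> (M n) (H x) - \<rho> (M n) (H y)\<bar> \<le> L * L1_dist n (H x) (H y)"
    and const: "\<And>n x. x \<in> X \<Longrightarrow> \<bar>\<rho> (M n) (H x) - H x t\<bar> \<le> L * L1_dist n (H x) (\<lambda>_. H x t)"
  shows "(\<lambda>n. deviation N (argmin_set X (\<lambda>x. \<rho> (M n) (H x))) (argmin_set X (\<lambda>x. H x t))) \<longlonglongrightarrow> 0"
proof (rule deviation_argmin_tendsto[OF norm compact_X X_ne H_t])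
  show "continuous_on X (\<lambda>x. \<rho> (M n) (H x))" for n
    unfolding continuous_on_def
  proof
    fix x assume x: "x \<in> X"
    have lim: "((\<lambda>y. L * L1_dist n (H y) (H x)) \<longlongrightarrow> 0) (at x within X)"
      using L1 x unfolding L1_continuous_def by (intro tendsto_mult_right_zero) blast
    have "((\<lambda>y. \<rho> (M n) (H y) - \<rho> (M n) (H x)) \<longlongrightarrow> 0) (at x within X)"
      by (rule Lim_null_comparison[OF _ lim]) (auto simp: eventually_at_filter lip[OF _ x])
    then show "((\<lambda>y. \<rho> (M n) (H y)) \<longlongrightarrow> \<rho> (M n) (H x)) (at x within X)" by (rule LIM_zero_cancel)
  qed
  show "uniform_limit X (\<lambda>n x. \<rho> (M n) (H x)) (\<lambda>x. H x t) sequentially"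
  proof (rule uniform_limitI)
    fix e :: real assume "0 < e"
    then have "\<forall>\<^sub>F n in sequentially. \<forall>x\<in>X. L1_dist n (H x) (\<lambda>_. H x t) < e / L"
      using unif L unfolding uniformly_L1_consistent_def by simp
    then show "\<forall>\<^sub>F n in sequentially. \<forall>x\<in>X. dist (\<rho> (M n) (H x)) (H x t) < e"
    proof eventually_elim
      case (elim n)
      have "dist (\<rho> (M n) (H x)) (H x t) < e" if x: "x \<in> X" for x
      proof -
        have "L * L1_dist n (H x) (\<lambda>_. H x t) < L * (e / L)" using elim x L by (intro mult_strict_left_mono) auto
        then show ?thesis using const[OF x, of n] L by (simp add: dist_real_def)
      qed
      then show ?case by blast
    qed
  qed
qed

lemma deviation_expectation:
  assumes uniformly_L1_consistent L1_continuous "continuous_on X (\<lambda>x. H x t)"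
  shows "(\<lambda>n. deviation N (argmin_set X (\<lambda>x. expectation n (H x))) (argmin_set X (\<lambda>x. H x t))) \<longlonglongrightarrow> 0"
proof (rule deviation_lipschitz_risk[where L=1, OF assms])
  show "\<bar>expectation n (H x) - expectation n (H y)\<bar> \<le> 1 * L1_dist n (H x) (H y)" if "x \<in> X" "y \<in> X" for n x y
    using expectation_lipschitz[of n "H x" "H y"] continuous_integrable cont_H that by simp
  show "\<bar>expectation n (H x) - H x t\<bar> \<le> 1 * L1_dist n (H x) (\<lambda>_. H x t)" if "x \<in> X" for n x
    using expectation_lipschitz[of n "H x" "\<lambda>_. H x t"] continuous_integrable cont_H that by (simp add: prob_space)
qed simp

lemma deviation_CVaR:
  assumes "uniformly_L1_consistent" L1_continuous "continuous_on X (\<lambda>x. H x t)" and \<alpha>: "0 < \<alpha>" "\<alpha> < 1"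
  shows "(\<lambda>n. deviation N (argmin_set X (\<lambda>x. CVaR \<alpha> (M n) (H x))) (argmin_set X (\<lambda>x. H x t))) \<longlonglongrightarrow> 0"
proof (rule deviation_lipschitz_risk[where L="1 / (1 - \<alpha>)", OF assms(1-3)])
  show "\<bar>CVaR \<alpha> (M n) (H x) - CVaR \<alpha> (M n) (H y)\<bar> \<le> 1 / (1 - \<alpha>) * L1_dist n (H x) (H y)"
    if "x \<in> X" "y \<in> X" for n x y
    using continuous_integrable cont_H that by (intro CVaR_lipschitz \<alpha>) auto
  show "\<bar>CVaR \<alpha> (M n) (H x) - H x t\<bar> \<le> 1 / (1 - \<alpha>) * L1_dist n (H x) (\<lambda>_. H x t)" if "x \<in> X" for n x
    using CVaR_lipschitz[of n "H x" "\<lambda>_. H x t" \<alpha>] continuous_integrable cont_H that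
    by (simp add: CVaR_const \<alpha>)
qed (use \<alpha> in simp)

lemma deviation_mean_variance:
  assumes uniformly_L1_consistent L1_continuous "continuous_on X (\<lambda>x. H x t)" and w: "0 \<le> w"
    and B: "\<And>x \<theta>. x \<in> X \<Longrightarrow> \<theta> \<in> \<Theta> \<Longrightarrow> \<bar>H x \<theta>\<bar> \<le> B"
  shows "(\<lambda>n. deviation N (argmin_set X (\<lambda>x. mean_variance w (M n) (H x))) (argmin_set X (\<lambda>x. H x t))) \<longlonglongrightarrow> 0"
proof (rule deviation_lipschitz_risk[where L="1 + 4 * B * w", OF assms(1-3)])
  obtain x where "x \<in> X" using X_ne by blast
  then have "0 \<le> B" using B[of x t] t by linarith
  then show "0 < 1 + 4 * B * w" using w by (simp add: add_pos_nonneg)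
  show "\<bar>mean_variance w (M n) (H x) - mean_variance w (M n) (H y)\<bar> \<le> (1 + 4 * B * w) * L1_dist n (H x) (H y)"
    if "x \<in> X" "y \<in> X" for n x y
    using continuous_measurable cont_H that B by (intro mean_variance_lipschitz w) (auto simp: space_M)
  show "\<bar>mean_variance w (M n) (H x) - H x t\<bar> \<le> (1 + 4 * B * w) * L1_dist n (H x) (\<lambda>_. H x t)"
    if "x \<in> X" for n x
    using mean_variance_lipschitz[of "H x" n "\<lambda>_. H x t" w B] continuous_measurable cont_H that B w t
    by (simp add: mean_variance_const space_M)
qed

text \<open>Without a Lipschitz bound in L1 the two tasks are split: the almost sure bound gives
  continuity in x for fixed n, and \<open>VaR_near_const\<close> gives the uniform limit.\<close>

lemma deviation_VaR:
  assumes unif: uniformly_L1_consistent and H_t: "continuous_on X (\<lambda>x. H x t)" and \<alpha>: "0 < \<alpha>" "\<alpha> < 1"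
    and lip: "\<And>n x y. x \<in> X \<Longrightarrow> y \<in> X \<Longrightarrow> AE \<theta> in M n. \<bar>H x \<theta> - H y \<theta>\<bar> \<le> c * N (x - y)"
  shows "(\<lambda>n. deviation N (argmin_set X (\<lambda>x. VaR \<alpha> (M n) (H x))) (argmin_set X (\<lambda>x. H x t))) \<longlonglongrightarrow> 0"
proof (rule deviation_argmin_tendsto[OF norm compact_X X_ne H_t])
  note meas = continuous_measurable[OF cont_H]
  show "continuous_on X (\<lambda>x. VaR \<alpha> (M n) (H x))" for n
    unfolding continuous_on_def
  proof
    fix x assume x: "x \<in> X"
    have "continuous_on UNIV (\<lambda>y. c * N (y - x))"
      by (intro continuous_intros continuous_on_compose2[OF continuous_on_is_norm[OF norm, of UNIV]]) auto
    then have "((\<lambda>y. c * N (y - x)) \<longlongrightarrow> c * N (x - x)) (at x within X)"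
      unfolding continuous_on_def using tendsto_within_subset by blast
    moreover have "N 0 = 0" using norm unfolding is_norm_def by blast
    ultimately have lim: "((\<lambda>y. c * N (y - x)) \<longlongrightarrow> 0) (at x within X)" by simp
    have "((\<lambda>y. VaR \<alpha> (M n) (H y) - VaR \<alpha> (M n) (H x)) \<longlongrightarrow> 0) (at x within X)"
      using VaR_lipschitz[OF meas meas \<alpha> lip[OF _ x]] x
      by (intro Lim_null_comparison[OF _ lim]) (auto simp: eventually_at_filter)
    then show "((\<lambda>y. VaR \<alpha> (M n) (H y)) \<longlongrightarrow> VaR \<alpha> (M n) (H x)) (at x within X)" by (rule LIM_zero_cancel)
  qed
  show "uniform_limit X (\<lambda>n x. VaR \<alpha> (M n) (H x)) (\<lambda>x. H x t) sequentially"
  proof (rule uniform_limitI)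
    fix e :: real assume e: "0 < e"
    then have "0 < e / 2 * min \<alpha> (1 - \<alpha>)" using \<alpha> by simp
    then have "\<forall>\<^sub>F n in sequentially. \<forall>x\<in>X. L1_dist n (H x) (\<lambda>_. H x t) < e / 2 * min \<alpha> (1 - \<alpha>)"
      using unif unfolding uniformly_L1_consistent_def by blast
    then show "\<forall>\<^sub>F n in sequentially. \<forall>x\<in>X. dist (VaR \<alpha> (M n) (H x)) (H x t) < e"
    proof eventually_elim
      case (elim n)
      have "dist (VaR \<alpha> (M n) (H x)) (H x t) < e" if x: "x \<in> X" for x
      proof -
        have "\<bar>VaR \<alpha> (M n) (H x) - H x t\<bar> \<le> e / 2"
          using elim x e by (intro VaR_near_const \<alpha> meas integrable_abs_diff cont_H continuous_on_const) auto
        then show ?thesis using e by (simp add: dist_real_def)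
      qed
      then show ?case by blast
    qed
  qed
qed

text \<open>On the compact product \<open>H\<close> is bounded and uniformly continuous, so
  neighbourhood and bound in \<open>L1_dist_const_le\<close> can be chosen for all x at
  once.\<close>

lemma jointly_continuous:
  assumes joint: "continuous_on (X \<times> \<Theta>) (\<lambda>(x, \<theta>). H x \<theta>)"
  shows "uniformly_L1_consistent" "L1_continuous" "continuous_on X (\<lambda>x. H x t)"
    "\<exists>B. \<forall>x\<in>X. \<forall>\<theta>\<in>\<Theta>. \<bar>H x \<theta>\<bar> \<le> B"
proof -
  have comp: "compact (X \<times> \<Theta>)" by (intro compact_Times compact_X compact_\<Theta>)
  obtain B where B: "0 < B" "\<And>x \<theta>. x \<in> X \<Longrightarrow> \<theta> \<in> \<Theta> \<Longrightarrow> \<bar>H x \<theta>\<bar> \<le> B"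
    using compact_imp_bounded[OF compact_continuous_image[OF joint comp]] by (auto simp: bounded_pos)
  then show "\<exists>B. \<forall>x\<in>X. \<forall>\<theta>\<in>\<Theta>. \<bar>H x \<theta>\<bar> \<le> B" by blast
  have "uniformly_continuous_on (X \<times> \<Theta>) (\<lambda>(x, \<theta>). H x \<theta>)"
    by (rule compact_uniformly_continuous[OF joint comp])
  then have uc: "\<exists>d>0. \<forall>x\<in>X. \<forall>y\<in>X. \<forall>\<theta>\<in>\<Theta>. \<forall>\<theta>'\<in>\<Theta>. dist (y, \<theta>') (x, \<theta>) < d \<longrightarrow> \<bar>H y \<theta>' - H x \<theta>\<bar> < e"
    if "0 < e" for e
    using that unfolding uniformly_continuous_on_def by (fastforce simp: dist_real_def)
  show "uniformly_L1_consistent"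
    unfolding uniformly_L1_consistent_def
  proof (intro allI impI)
    fix e :: real assume e: "0 < e"
    then obtain d where d: "0 < d" "\<And>x \<theta> \<theta>'. x \<in> X \<Longrightarrow> \<theta> \<in> \<Theta> \<Longrightarrow> \<theta>' \<in> \<Theta> \<Longrightarrow> dist \<theta>' \<theta> < d \<Longrightarrow> \<bar>H x \<theta>' - H x \<theta>\<bar> < e / 2"
      using uc[of "e / 2"] by (auto simp: dist_Pair_Pair)
    have "(\<lambda>n. 2 * B * measure (M n) (\<Theta> - ball t d)) \<longlonglongrightarrow> 2 * B * 0"
      using d(1) by (intro tendsto_intros conc) auto
    then have "\<forall>\<^sub>F n in sequentially. 2 * B * measure (M n) (\<Theta> - ball t d) < e / 2"
      using e by (intro order_tendstoD(2)) auto
    then show "\<forall>\<^sub>F n in sequentially. \<forall>x\<in>X. L1_dist n (H x) (\<lambda>_. H x t) < e"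
    proof eventually_elim
      case (elim n)
      have "L1_dist n (H x) (\<lambda>_. H x t) \<le> e / 2 + 2 * B * measure (M n) (\<Theta> - ball t d)" if x: "x \<in> X" for x
        using d(2)[OF x t] B(2)[OF x] e
        by (intro L1_dist_const_le cont_H x) (auto simp: dist_commute less_imp_le)
      then show ?case using elim by fastforce
    qed
  qed
  show "L1_continuous"
    unfolding L1_continuous_def
  proof (intro allI ballI tendstoI)
    fix n x and e :: real assume x: "x \<in> X" and e: "0 < e"
    then obtain d where d: "0 < d" "\<And>y \<theta>. y \<in> X \<Longrightarrow> \<theta> \<in> \<Theta> \<Longrightarrow> dist y x < d \<Longrightarrow> \<bar>H y \<theta> - H x \<theta>\<bar> < e / 2"
      using uc[of "e / 2"] by (auto simp: dist_Pair_Pair)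
    have "dist (L1_dist n (H y) (H x)) 0 < e" if y: "y \<in> X" "dist y x < d" for y
    proof -
      have "L1_dist n (H y) (H x) \<le> (\<integral>\<theta>. e / 2 \<partial>M n)"
        using d(2)[OF y(1) _ y(2)]
        by (intro integral_mono integrable_abs_diff cont_H x y) (auto simp: space_M less_imp_le)
      then show ?thesis using e by (simp add: prob_space abs_of_nonneg)
    qed
    then show "\<forall>\<^sub>F y in at x within X. dist (L1_dist n (H y) (H x)) 0 < e"
      using d(1) unfolding eventually_at by blast
  qed
  show "continuous_on X (\<lambda>x. H x t)"
  proof -
    have "continuous_on X (\<lambda>x. (x, t))" by (intro continuous_intros)
    from continuous_on_compose2[OF joint this] show ?thesis using t by auto
  qed
qed

text \<open>The bound c on the integrals of \<kappa> makes the L1 error Lipschitz in x with a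
  constant independent of n. Convergence on a finite net, where continuity of each single
  \<open>H x\<close> suffices, therefore extends to all of \<open>X\<close>.\<close>

lemma lipschitz_in_decision:
  assumes \<kappa>: "\<kappa> \<in> borel_measurable (borel_on \<Theta>)" "\<And>\<theta>. \<theta> \<in> \<Theta> \<Longrightarrow> 0 \<le> \<kappa> \<theta>"
    and lip: "\<And>x y \<theta>. x \<in> X \<Longrightarrow> y \<in> X \<Longrightarrow> \<theta> \<in> \<Theta> \<Longrightarrow> \<bar>H x \<theta> - H y \<theta>\<bar> \<le> \<kappa> \<theta> * N (x - y)"
    and c: "0 \<le> c" "\<And>n. (\<integral>\<^sup>+\<theta>. ennreal (\<kappa> \<theta>) \<partial>M n) \<le> ennreal c"
  shows "uniformly_L1_consistent" "L1_continuous" "continuous_on X (\<lambda>x. H x t)"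
proof -
  obtain C where C: "0 < C" "\<And>x. N x \<le> C * norm x" using is_norm_bound[OF norm] by blast
  have N0: "0 \<le> N x" for x using norm unfolding is_norm_def by blast
  have \<kappa>M: "\<kappa> \<in> borel_measurable (M n)" for n using \<kappa>(1) by (simp add: measurable_cong_sets[OF sets_M refl])
  have int: "integrable (M n) \<kappa>" for n
    using \<kappa>M \<kappa>(2) c(2)[of n] by (intro integrableI_nonneg) (auto simp: space_M le_less_trans[OF _ ennreal_less_top])
  have mean: "expectation n \<kappa> \<le> c" for n
  proof -
    have "AE \<theta> in M n. 0 \<le> \<kappa> \<theta>" using \<kappa>(2) by (intro AE_I2) (simp add: space_M)
    from nn_integral_eq_integral[OF int this] show ?thesis using c by (metis ennreal_le_iff)
  qed
  have L1: "L1_dist n (H x) (H y) \<le> c * N (x - y)" if x: "x \<in> X" "y \<in> X" for n x y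
  proof -
    have "L1_dist n (H x) (H y) \<le> (\<integral>\<theta>. \<kappa> \<theta> * N (x - y) \<partial>M n)"
      using lip[OF x] int by (intro integral_mono integrable_abs_diff cont_H x) (auto simp: space_M)
    also have "\<dots> \<le> c * N (x - y)" using mean N0 by (simp add: mult_right_mono)
    finally show ?thesis .
  qed
  have Nlim: "((\<lambda>y. k * N (y - x)) \<longlongrightarrow> 0) (at x within X)" for k x
  proof -
    have "continuous_on UNIV (\<lambda>y. k * N (y - x))"
      by (intro continuous_intros continuous_on_compose2[OF continuous_on_is_norm[OF norm, of UNIV]]) auto
    then have "((\<lambda>y. k * N (y - x)) \<longlongrightarrow> k * N (x - x)) (at x within X)"
      unfolding continuous_on_def using tendsto_within_subset by blast
    moreover have "N 0 = 0" using norm unfolding is_norm_def by blast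
    ultimately show ?thesis by simp
  qed
  show "L1_continuous"
    unfolding L1_continuous_def
  proof (intro allI ballI)
    show "((\<lambda>y. L1_dist n (H y) (H x)) \<longlongrightarrow> 0) (at x within X)" if x: "x \<in> X" for n x
      using L1[OF _ x, of _ n] by (intro Lim_null_comparison[OF _ Nlim[of c x]]) (auto simp: eventually_at_filter)
  qed
  show "continuous_on X (\<lambda>x. H x t)"
    unfolding continuous_on_def
  proof
    fix x assume x: "x \<in> X"
    have "((\<lambda>y. H y t - H x t) \<longlongrightarrow> 0) (at x within X)"
      using lip[OF _ x t] by (intro Lim_null_comparison[OF _ Nlim[of "\<kappa> t" x]]) (auto simp: eventually_at_filter)
    then show "((\<lambda>y. H y t) \<longlongrightarrow> H x t) (at x within X)" by (rule LIM_zero_cancel)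
  qed
  let ?A = "\<lambda>n x. L1_dist n (H x) (\<lambda>_. H x t)"
  \<comment> \<open>The change in x acts both under the integral, with cost c, and in the value at
    the true parameter, with cost \<open>\<kappa> t\<close>.\<close>
  have Alip: "?A n x \<le> ?A n y + (c + \<kappa> t) * N (x - y)" if x: "x \<in> X" "y \<in> X" for n x y
  proof -
    have "?A n x \<le> (\<integral>\<theta>. \<bar>H y \<theta> - H y t\<bar> + (\<bar>H x \<theta> - H y \<theta>\<bar> + \<kappa> t * N (x - y)) \<partial>M n)"
    proof (intro integral_mono)
      show "\<bar>H x \<theta> - H x t\<bar> \<le> \<bar>H y \<theta> - H y t\<bar> + (\<bar>H x \<theta> - H y \<theta>\<bar> + \<kappa> t * N (x - y))" for \<theta>
        using lip[OF x t] by linarith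
    qed (auto intro!: integrable_abs_diff cont_H x)
    also have "\<dots> = ?A n y + (L1_dist n (H x) (H y) + \<kappa> t * N (x - y))"
      by (subst Bochner_Integration.integral_add, auto intro!: integrable_abs_diff cont_H x,
          subst Bochner_Integration.integral_add, auto intro!: integrable_abs_diff cont_H x simp: prob_space)
    also have "\<dots> \<le> ?A n y + (c + \<kappa> t) * N (x - y)" using L1[OF x, of n] by (simp add: algebra_simps)
    finally show ?thesis .
  qed
  show "uniformly_L1_consistent"
    unfolding uniformly_L1_consistent_def
  proof (intro allI impI)
    fix e :: real assume e: "0 < e"
    \<comment> \<open>A Lipschitz constant of the errors for the Euclidean distance, raised by 1 to
      be positive. The mesh \<delta> is chosen so that K * \<delta> = e / 2, leaving e / 2 for the
      error at the net points.\<close>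
    define K where "K = (c + \<kappa> t) * C + 1"
    have K: "0 < K" using c(1) \<kappa>(2)[OF t] C(1) by (simp add: K_def add_nonneg_pos)
    define \<delta> where "\<delta> = e / (2 * K)"
    have \<delta>: "0 < \<delta>" using e K by (simp add: \<delta>_def)
    have "X \<subseteq> (\<Union>y\<in>X. ball y \<delta>)" using \<delta> by force
    then obtain Y where Y: "Y \<subseteq> X" "finite Y" "X \<subseteq> (\<Union>y\<in>Y. ball y \<delta>)"
      using compactE_image[OF compact_X, of X "\<lambda>y. ball y \<delta>"] by blast
    have "\<forall>\<^sub>F n in sequentially. \<forall>y\<in>Y. ?A n y < e / 2"
      unfolding eventually_ball_finite_distrib[OF Y(2)]
      using Y(1) e by (intro ballI order_tendstoD(2)[OF L1_dist_const_tendsto_0] cont_H) auto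
    then show "\<forall>\<^sub>F n in sequentially. \<forall>x\<in>X. ?A n x < e"
    proof eventually_elim
      case (elim n)
      have "?A n x < e" if x: "x \<in> X" for x
      proof -
        obtain y where y: "y \<in> Y" "dist x y < \<delta>" using Y(3) x by (auto simp: dist_commute)
        have "(c + \<kappa> t) * N (x - y) \<le> (c + \<kappa> t) * (C * \<delta>)"
          using C(1) C(2)[of "x - y"] y(2) c(1) \<kappa>(2)[OF t]
          by (intro mult_left_mono) (auto simp: dist_norm intro: order_trans[OF _ mult_left_mono])
        also have "\<dots> \<le> K * \<delta>" using \<delta> by (simp add: K_def algebra_simps)
        also have "\<dots> = e / 2" using K by (simp add: \<delta>_def)
        finally have "(c + \<kappa> t) * N (x - y) \<le> e / 2" .
        moreover have "?A n x \<le> ?A n y + (c + \<kappa> t) * N (x - y)" using Alip x y(1) Y(1) by blast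
        moreover have "?A n y < e / 2" using elim y(1) by blast
        ultimately show ?thesis by linarith
      qed
      then show ?case by blast
    qed
  qed
qed

end

section \<open>From fixed posterior sequences to the almost sure statement\<close>

theorem theorem3p2:
  fixes \<Theta> :: "(real ^ 'l) set" and \<Xi> :: "(real ^ 'm) set" and X :: "(real ^ 'd) set"
    and nrm :: "real ^ 'd \<Rightarrow> real"
    and \<pi> :: "(real ^ 'l) measure"
    and P :: "real ^ 'l \<Rightarrow> (real ^ 'm) measure"
    and \<mu> :: "((real ^ 'l) \<times> (nat \<Rightarrow> real ^ 'm)) measure"
    and post :: "nat \<Rightarrow> (real ^ 'l) \<times> (nat \<Rightarrow> real ^ 'm) \<Rightarrow> (real ^ 'l) measure"
    and h :: "real ^ 'd \<Rightarrow> real ^ 'm \<Rightarrow> real"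
    and H :: "real ^ 'd \<Rightarrow> real ^ 'l \<Rightarrow> real"
    and E\<^sub>\<Xi> :: "'p::polish_space set" and E\<^sub>\<Theta> :: "'q::polish_space set"
    and \<rho> :: "(real ^ 'l) measure \<Rightarrow> (real ^ 'l \<Rightarrow> real) \<Rightarrow> real"
  assumes prior: "prob_space \<pi>" "sets \<pi> = sets (borel_on \<Theta>)"
    and family: "\<And>\<theta>. \<theta> \<in> \<Theta> \<Longrightarrow> prob_space (P \<theta>)" "\<And>\<theta>. \<theta> \<in> \<Theta> \<Longrightarrow> sets (P \<theta>) = sets (borel_on \<Xi>)"
    and family_measurable:
      "\<And>B. B \<in> sets (seq_algebra \<Xi>) \<Longrightarrow> (\<lambda>\<theta>. emeasure (seq_law P \<theta>) B) \<in> borel_measurable (borel_on \<Theta>)"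
    and joint: "is_joint_law \<Theta> \<Xi> \<pi> P \<mu>"
    and posterior: "\<And>n. regular_cond_distr \<mu> (obs_algebra \<Xi> \<mu> n) (borel_on \<Theta>) fst (post n)"
    and norm: "is_norm nrm"
    and H_def: "H = mean_loss h P"
    and H_finite: "\<And>x \<theta>. x \<in> X \<Longrightarrow> \<theta> \<in> \<Theta> \<Longrightarrow> integrable (P \<theta>) (h x)"
    and iso_\<Xi>: "E\<^sub>\<Xi> \<in> sets borel" "measurably_isomorphic (borel_on \<Xi>) (borel_on E\<^sub>\<Xi>)"
    and iso_\<Theta>: "E\<^sub>\<Theta> \<in> sets borel" "measurably_isomorphic (borel_on \<Theta>) (borel_on E\<^sub>\<Theta>)"
    and identifiable: "\<And>\<theta>\<^sub>1 \<theta>\<^sub>2. \<theta>\<^sub>1 \<in> \<Theta> \<Longrightarrow> \<theta>\<^sub>2 \<in> \<Theta> \<Longrightarrow> \<theta>\<^sub>1 \<noteq> \<theta>\<^sub>2 \<Longrightarrow>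
      \<exists>A\<in>sets (seq_algebra \<Xi>). emeasure (seq_law P \<theta>\<^sub>1) A \<noteq> emeasure (seq_law P \<theta>\<^sub>2) A"
    and compact: "compact \<Theta>" "compact X" "X \<noteq> {}"
    and continuous: "\<And>x. x \<in> X \<Longrightarrow> continuous_on \<Theta> (H x)"
    and choice_of_\<rho>:
      "(\<rho> = prob_space.expectation \<or> (\<exists>\<alpha>. 0 < \<alpha> \<and> \<alpha> < 1 \<and> \<rho> = CVaR \<alpha>)) \<and>
         (\<exists>\<kappa>. lipschitz_modulus nrm X \<Theta> \<pi> H \<kappa>)
       \<or> (\<exists>w\<ge>0. \<rho> = mean_variance w) \<and> continuous_on (X \<times> \<Theta>) (\<lambda>(x, \<theta>). H x \<theta>)
       \<or> (\<exists>\<alpha>. 0 < \<alpha> \<and> \<alpha> < 1 \<and> \<rho> = VaR \<alpha>) \<and>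
         (\<exists>\<kappa>. lipschitz_modulus nrm X \<Theta> \<pi> H \<kappa> \<and> esssup \<pi> (\<lambda>\<theta>. ereal \<bar>\<kappa> \<theta>\<bar>) < \<infinity>)"
  shows "AE \<omega> in \<mu>.
    (\<lambda>n. deviation nrm (argmin_set X (\<lambda>x. \<rho> (post n \<omega>) (H x)))
                       (argmin_set X (\<lambda>x. H x (fst \<omega>)))) \<longlonglongrightarrow> 0"
proof -
  interpret bayesian_posterior \<Theta> \<Xi> \<pi> P \<mu> post
  proof (intro bayesian_posterior.intro bayesian_model.intro bayesian_posterior_axioms.intro)
    show "\<Theta> \<in> sets borel" using compact(1) by (rule borel_compact)
  qed (fact prior family family_measurable joint posterior identifiable)+
  let ?S = "\<lambda>\<omega>. argmin_set X (\<lambda>x. H x (fst \<omega>))"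
  let ?conv = "\<lambda>\<omega>. (\<lambda>n. deviation nrm (argmin_set X (\<lambda>x. \<rho> (post n \<omega>) (H x))) (?S \<omega>)) \<longlonglongrightarrow> 0"
  have AE_conc: "AE \<omega> in \<mu>. concentrating_measures \<Theta> (\<lambda>n. post n \<omega>) (fst \<omega>) X nrm H"
    using posterior_consistency AE_space
  proof eventually_elim
    case (elim \<omega>)
    have "fst \<omega> \<in> \<Theta>" using elim(2) by (auto simp: space_\<mu>)
    then show ?case
      using elim prob_space_post sets_post compact norm continuous
      by (intro concentrating_measures.intro) simp_all
  qed
  \<comment> \<open>The bound c on the posterior integrals of \<kappa> depends on the outcome. Only
    the resulting properties are recorded, so that they combine with concentration outside one null
    set.\<close>
  have AE_lip: "AE \<omega> in \<mu>.
      concentrating_measures.uniformly_L1_consistent (\<lambda>n. post n \<omega>) (fst \<omega>) X H \<and>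
      concentrating_measures.L1_continuous (\<lambda>n. post n \<omega>) X H \<and>
      continuous_on X (\<lambda>x. H x (fst \<omega>))"
    if \<kappa>: "lipschitz_modulus nrm X \<Theta> \<pi> H \<kappa>" for \<kappa>
  proof -
    have \<kappa>m: "\<kappa> \<in> borel_measurable (borel_on \<Theta>)"
      using \<kappa> by (simp add: lipschitz_modulus_def measurable_cong_sets[OF prior(2) refl])
    have "AE \<omega> in \<mu>. \<exists>c::real. 0 \<le> c \<and> (\<forall>n. (\<integral>\<^sup>+\<theta>. ennreal (\<kappa> \<theta>) \<partial>post n \<omega>) \<le> ennreal c)"
      using \<kappa> \<kappa>m by (intro AE_post_nn_integral_bounded) (auto simp: lipschitz_modulus_def)
    with AE_conc show ?thesis
    proof eventually_elim
      case (elim \<omega>)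
      then interpret concentrating_measures \<Theta> "\<lambda>n. post n \<omega>" "fst \<omega>" X nrm H by blast
      from elim obtain c :: real where "0 \<le> c" "\<And>n. (\<integral>\<^sup>+\<theta>. ennreal (\<kappa> \<theta>) \<partial>post n \<omega>) \<le> ennreal c" by blast
      note lipschitz_in_decision[OF \<kappa>m _ _ this]
      then show ?case using \<kappa> by (auto simp: lipschitz_modulus_def)
    qed
  qed
  from choice_of_\<rho> consider
    (expectation) \<kappa> where "\<rho> = prob_space.expectation" "lipschitz_modulus nrm X \<Theta> \<pi> H \<kappa>"
    | (CVaR) \<alpha> \<kappa> where "0 < \<alpha>" "\<alpha> < 1" "\<rho> = CVaR \<alpha>" "lipschitz_modulus nrm X \<Theta> \<pi> H \<kappa>"
    | (mean_variance) w where "0 \<le> w" "\<rho> = mean_variance w" "continuous_on (X \<times> \<Theta>) (\<lambda>(x, \<theta>). H x \<theta>)"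
    | (VaR) \<alpha> \<kappa> where "0 < \<alpha>" "\<alpha> < 1" "\<rho> = VaR \<alpha>" "lipschitz_modulus nrm X \<Theta> \<pi> H \<kappa>"
      "esssup \<pi> (\<lambda>\<theta>. ereal \<bar>\<kappa> \<theta>\<bar>) < \<infinity>"
    by blast
  then show ?thesis
  proof cases
    case expectation
    from AE_conc AE_lip[OF expectation(2)] show ?thesis
    proof eventually_elim
      case (elim \<omega>)
      then interpret concentrating_measures \<Theta> "\<lambda>n. post n \<omega>" "fst \<omega>" X nrm H by blast
      show ?case using deviation_expectation elim by (simp add: expectation(1))
    qed
  next
    case CVaR
    from AE_conc AE_lip[OF CVaR(4)] show ?thesis
    proof eventually_elim
      case (elim \<omega>)
      then interpret concentrating_measures \<Theta> "\<lambda>n. post n \<omega>" "fst \<omega>" X nrm H by blast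
      show ?case using deviation_CVaR[OF _ _ _ CVaR(1,2)] elim by (simp add: CVaR(3))
    qed
  next
    case mean_variance
    from AE_conc show ?thesis
    proof eventually_elim
      case (elim \<omega>)
      then interpret concentrating_measures \<Theta> "\<lambda>n. post n \<omega>" "fst \<omega>" X nrm H .
      note jc = jointly_continuous[OF mean_variance(3)]
      obtain B where "\<And>x \<theta>. x \<in> X \<Longrightarrow> \<theta> \<in> \<Theta> \<Longrightarrow> \<bar>H x \<theta>\<bar> \<le> B" using jc(4) by blast
      from deviation_mean_variance[OF jc(1-3) mean_variance(1) this] show ?case
        by (simp add: mean_variance(2))
    qed
  next
    case VaR
    obtain C where C: "AE \<theta> in \<pi>. \<bar>\<kappa> \<theta>\<bar> \<le> C"
    proof -
      have "AE \<theta> in \<pi>. \<bar>\<kappa> \<theta>\<bar> \<le> real_of_ereal (max 0 (esssup \<pi> (\<lambda>\<theta>. ereal \<bar>\<kappa> \<theta>\<bar>)))"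
        using esssup_AE[of "\<lambda>\<theta>. ereal \<bar>\<kappa> \<theta>\<bar>" \<pi>]
      proof eventually_elim
        case (elim \<theta>)
        then show ?case using VaR(5) by (cases "esssup \<pi> (\<lambda>\<theta>. ereal \<bar>\<kappa> \<theta>\<bar>)") (auto simp: max_def)
      qed
      then show ?thesis by (rule that)
    qed
    \<comment> \<open>The essential bound on \<kappa> refers to the prior, while the Lipschitz
      estimate for \<open>VaR\<close> needs it almost everywhere under each posterior;
      \<open>AE_post_AE\<close> transfers it for all n simultaneously.\<close>
    from AE_conc AE_lip[OF VaR(4)] AE_post_AE[OF C] AE_space show ?thesis
    proof eventually_elim
      case (elim \<omega>)
      then interpret concentrating_measures \<Theta> "\<lambda>n. post n \<omega>" "fst \<omega>" X nrm H by blast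
      have nn: "0 \<le> nrm x" for x using norm unfolding is_norm_def by blast
      have "AE \<theta> in post n \<omega>. \<bar>H x \<theta> - H y \<theta>\<bar> \<le> C * nrm (x - y)" if "x \<in> X" "y \<in> X" for n x y
      proof -
        have "AE \<theta> in post n \<omega>. \<bar>\<kappa> \<theta>\<bar> \<le> C" using elim by blast
        with AE_space show ?thesis
        proof eventually_elim
          case (elim \<theta>)
          then have "\<bar>H x \<theta> - H y \<theta>\<bar> \<le> \<kappa> \<theta> * nrm (x - y)"
            using VaR(4) that by (simp add: lipschitz_modulus_def space_M)
          also have "\<dots> \<le> C * nrm (x - y)" using elim nn by (intro mult_right_mono) auto
          finally show ?case .
        qed
      qed
      from deviation_VaR[OF _ _ VaR(1,2) this] show ?case using elim by (simp add: VaR(3))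
    qed
  qed
qed

end
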